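(* Let $n\ge1$ and $t>0$. Suppose $F$ is a holomorphic function on $\mathbb{C}^n$. Then there exists a tempered distribution $f\in\mathcal{S}'(\mathbb{R}^n)$ with $F=e^{-tH}f$ if and only if there are a non-negative integer $m$ and a constant $C$ such that for all $z=x+iy\in\mathbb{C}^n$ ($x,y\in\mathbb{R}^n$) $$|F(z)|^2\le C(1+|z|^2)^{2m}e^{-x^2\tanh 2t+y^2\coth 2t}.$$
   Context: For $x\in\mathbb{R}^n$, $x^2=x_1^2+\cdots+x_n^2$; for $z=x+iy\in\mathbb{C}^n$, $z^2=\sum z_j^2$, $|z|^2=x^2+y^2$, and $z\cdot u=\sum z_ju_j$. $e^{-tH}$ is the Hermite semigroup, with integral kernel (Mehler's formula) $K_t(z,u)=(2\pi)^{-n/2}(\sinh 2t)^{-n/2}e^{-\frac12\coth(2t)(z^2+u^2)+\frac{1}{\sinh 2t}z\cdot u}$, $z\in\mathbb{C}^n$, $u\in\mathbb{R}^n$. For $f\in\mathcal{S}'(\mathbb{R}^n)$, $e^{-tH}f$ denotes the entire function $e^{-tH}f(z)=\langle f,K_t(z,\cdot)\rangle$ on $\mathbb{C}^n$ (distributional pairing, bilinear, formally $\int f(u)K_t(z,u)\,du$). *)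

theory Defs
  imports "HOL-Analysis.Analysis"
begin

section \<open>Schwartz space and tempered distributions\<close>

definition partial_deriv :: "'n::finite \<Rightarrow> (real^'n \<Rightarrow> complex) \<Rightarrow> real^'n \<Rightarrow> complex" where
  "partial_deriv i \<phi> x = vector_derivative (\<lambda>h. \<phi> (x + h *\<^sub>R axis i 1)) (at 0)"

text \<open>A multi-index is encoded as a list of coordinate indices, one entry per differentiation.  Lists that are
  permutations of each other give the same operator on smooth functions.\<close>

fun iter_partial :: "'n::finite list \<Rightarrow> (real^'n \<Rightarrow> complex) \<Rightarrow> real^'n \<Rightarrow> complex" where
  "iter_partial [] \<phi> = \<phi>"
| "iter_partial (i # is) \<phi> = partial_deriv i (iter_partial is \<phi>)"

text \<open>Differentiability of all iterated partial derivatives makes each of them exist genuinely and be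
  continuous, so this is \<open>C\<^sup>\<infinity>\<close>.\<close>

definition smooth :: "(real^'n::finite \<Rightarrow> complex) \<Rightarrow> bool" where
  "smooth \<phi> \<longleftrightarrow> (\<forall>is x. iter_partial is \<phi> differentiable (at x))"

definition schwartz :: "(real^'n::finite \<Rightarrow> complex) set" where
  "schwartz = {\<phi>. smooth \<phi> \<and>
     (\<forall>k is. bdd_above (range (\<lambda>x. (1 + norm x) ^ k * norm (iter_partial is \<phi> x))))}"

definition schwartz_seminorm :: "nat \<Rightarrow> 'n::finite list \<Rightarrow> (real^'n \<Rightarrow> complex) \<Rightarrow> real" where
  "schwartz_seminorm k is \<phi> = (SUP x. (1 + norm x) ^ k * norm (iter_partial is \<phi> x))"

definition schwartz_topology :: "(real^'n::finite \<Rightarrow> complex) topology" where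
  "schwartz_topology = topology_generated_by
     {{\<psi> \<in> schwartz. schwartz_seminorm k is (\<lambda>x. \<psi> x - \<phi> x) < \<epsilon>} | k is \<phi> \<epsilon>.
        \<phi> \<in> schwartz \<and> 0 < \<epsilon>}"

lemma topspace_schwartz_topology [simp]: "topspace schwartz_topology = schwartz"
proof
  show "schwartz \<subseteq> topspace schwartz_topology"
  proof
    fix \<phi> :: "real^'n \<Rightarrow> complex" assume \<phi>: "\<phi> \<in> schwartz"
    let ?U = "{\<psi> \<in> schwartz. schwartz_seminorm 0 [] (\<lambda>x. \<psi> x - \<phi> x) < 1}"
    have "schwartz_seminorm 0 [] (\<lambda>x. \<phi> x - \<phi> x) = 0"
      unfolding schwartz_seminorm_def by simp
    with \<phi> have "\<phi> \<in> ?U" by simp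
    moreover have "?U \<in> {{\<psi> \<in> schwartz. schwartz_seminorm k is (\<lambda>x. \<psi> x - \<phi> x) < \<epsilon>} | k is \<phi> \<epsilon>.
        \<phi> \<in> schwartz \<and> 0 < \<epsilon>}"
      using \<phi> zero_less_one by blast
    ultimately show "\<phi> \<in> topspace schwartz_topology"
      unfolding schwartz_topology_def topology_generated_by_topspace by (rule UnionI[rotated])
  qed
qed (auto simp: schwartz_topology_def topology_generated_by_topspace)

text \<open>Distributions are total functions in HOL; only their values on \<^const>\<open>schwartz\<close> matter.  The
  pairing is complex bilinear: \<open>f \<phi>\<close> is formally \<open>\<integral> f(u) \<phi>(u) du\<close>, without conjugation.\<close>

definition tempered_distribution :: "((real^'n::finite \<Rightarrow> complex) \<Rightarrow> complex) \<Rightarrow> bool" where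
  "tempered_distribution f \<longleftrightarrow>
     (\<forall>\<phi>\<in>schwartz. \<forall>\<psi>\<in>schwartz. f (\<lambda>x. \<phi> x + \<psi> x) = f \<phi> + f \<psi>) \<and>
     (\<forall>c. \<forall>\<phi>\<in>schwartz. f (\<lambda>x. c * \<phi> x) = c * f \<phi>) \<and>
     continuous_map schwartz_topology euclidean f"

section \<open>Several complex variables and the Hermite semigroup\<close>

definition entire :: "(complex^'n::finite \<Rightarrow> complex) \<Rightarrow> bool" where
  "entire F \<longleftrightarrow> (\<forall>z. \<exists>D. (F has_derivative D) (at z) \<and> (\<forall>c v. D (c *s v) = c * D v))"

definition cvec :: "real^'n \<Rightarrow> real^'n \<Rightarrow> complex^'n::finite" where
  "cvec x y = (\<chi> j. Complex (x $ j) (y $ j))"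

definition coth :: "real \<Rightarrow> real" where
  "coth s = cosh s / sinh s"

text \<open>Mehler's formula; the squares \<open>z\<^sup>2\<close> and \<open>u\<^sup>2\<close> are the bilinear ones, without conjugation.\<close>

definition mehler_kernel :: "real \<Rightarrow> complex^'n::finite \<Rightarrow> real^'n \<Rightarrow> complex" where
  "mehler_kernel t z u =
     of_real ((2 * pi) powr (- (real CARD('n) / 2)) * sinh (2 * t) powr (- (real CARD('n) / 2))) *
     exp (- (1 / 2) * of_real (coth (2 * t)) *
            ((\<Sum>j\<in>UNIV. (z $ j)\<^sup>2) + (\<Sum>j\<in>UNIV. (of_real (u $ j))\<^sup>2))
          + 1 / of_real (sinh (2 * t)) * (\<Sum>j\<in>UNIV. z $ j * of_real (u $ j)))"

definition hermite_semigroup ::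
  "real \<Rightarrow> ((real^'n::finite \<Rightarrow> complex) \<Rightarrow> complex) \<Rightarrow> complex^'n \<Rightarrow> complex" where
  "hermite_semigroup t f z = f (mehler_kernel t z)"

end

theory Submission
  imports Defs "HOL-Probability.Probability" "HOL-Complex_Analysis.Complex_Analysis"
begin

text \<open>Write \<open>\<alpha> = tanh 2t\<close>, \<open>\<beta> = coth 2t\<close> and \<open>E(x,y) = exp ((\<beta> y\<^sup>2 - \<alpha> x\<^sup>2) / 2)\<close>.  Completing the square in
  Mehler's formula shows that \<open>|K\<^sub>t(x + iy, u)|\<close> is \<open>E(x,y)\<close> times a Gaussian in \<open>u - x / cosh 2t\<close>, so every
  Schwartz seminorm of the kernel is polynomial in \<open>z\<close> times \<open>E\<close>; this gives the growth bound.

  Conversely, \<open>e\<^sup>-\<^sup>t\<^sup>H\<close> is, up to a constant, unitary from \<open>L\<^sup>2\<close> onto a weighted Bergman space with weight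
  \<open>E\<^sup>-\<^sup>2\<close>, so \<open>f\<close> has to be the adjoint applied to \<open>F\<close>: up to a constant, \<open>f(\<phi>)\<close> is the integral over \<open>z\<close> of
  \<open>F(z) (e\<^sup>-\<^sup>t\<^sup>H \<phi>)(cnj z) E\<^sup>-\<^sup>2\<close>.  For Schwartz \<open>\<phi>\<close>, \<open>e\<^sup>-\<^sup>t\<^sup>H \<phi>\<close> decays faster than any power relative to
  \<open>E\<close>, so the integral converges and is continuous in \<open>\<phi>\<close>.  After removing the factor \<open>exp (- \<kappa> z\<^sup>2)\<close>,
  \<open>\<kappa> = (\<alpha> + \<beta>) / 4\<close>, from \<open>F\<close>, the identity \<open>f(K\<^sub>t(w, \<cdot>)) = F(w)\<close> is the reproducing formula of the Fock
  space with parameter \<open>(\<beta> - \<alpha>) / 2\<close>.  Translation by \<open>w\<close> reduces that formula to its value at \<open>0\<close>, where it is the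
  mean value property together with the invariance of Lebesgue measure under multiplication by \<open>exp(i\<theta>)\<close>.\<close>

section \<open>Seminorms and tempered distributions\<close>

text \<open>\<open>partial_deriv\<close> rests on a choice operator; composing with the affine line
  \<open>h \<mapsto> x + h e\<close> shows that total differentiability makes the chosen value a
  genuine derivative.\<close>

lemma partial_deriv_works:
  fixes \<phi> :: "real^'n::finite \<Rightarrow> complex"
  assumes "\<phi> differentiable (at x)"
  shows "((\<lambda>h. \<phi> (x + h *\<^sub>R axis i 1)) has_vector_derivative partial_deriv i \<phi> x) (at 0)"
proof -
  have "\<phi> differentiable (at (x + 0 *\<^sub>R axis i (1::real)))" using assms by simp
  then have "(\<lambda>h::real. \<phi> (x + h *\<^sub>R axis i 1)) differentiable (at 0)"
    using differentiable_chain_at[of "\<lambda>h::real. x + h *\<^sub>R axis i 1" 0 \<phi>]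
    by (simp add: o_def)
  then show ?thesis
    unfolding partial_deriv_def by (simp add: vector_derivative_works)
qed

lemma partial_deriv_eqI:
  assumes "((\<lambda>h. \<phi> (x + h *\<^sub>R axis i 1)) has_vector_derivative D) (at 0)"
  shows "partial_deriv i \<phi> x = D"
  unfolding partial_deriv_def using assms by (rule vector_derivative_at)

lemma smooth_differentiable: "smooth \<phi> \<Longrightarrow> iter_partial is \<phi> differentiable (at x)"
  by (simp add: smooth_def)

text \<open>Smoothness enters at every level of the induction, since linearity of
  \<open>partial_deriv\<close> holds only where the derivatives exist. Sums, differences and
  scalings are all read off from this one form.\<close>

lemma iter_partial_lincomb:
  assumes "smooth \<phi>" "smooth \<psi>"
  shows "iter_partial is (\<lambda>x. a * \<phi> x + b * \<psi> x) = (\<lambda>x. a * iter_partial is \<phi> x + b * iter_partial is \<psi> x)"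
proof (induction "is")
  case (Cons i "is")
  show ?case
    unfolding iter_partial.simps Cons
    by (rule ext, rule partial_deriv_eqI)
       (intro derivative_intros has_vector_derivative_mult_right partial_deriv_works smooth_differentiable assms)
qed simp

lemma smooth_lincomb:
  assumes "smooth \<phi>" "smooth \<psi>"
  shows "smooth (\<lambda>x. a * \<phi> x + b * \<psi> x)"
  unfolding smooth_def iter_partial_lincomb[OF assms]
  using assms by (auto simp: smooth_def intro!: derivative_intros)

lemma schwartz_imp_smooth: "\<phi> \<in> schwartz \<Longrightarrow> smooth \<phi>"
  by (simp add: schwartz_def)

lemma schwartz_seminorm_upper:
  assumes "\<phi> \<in> schwartz"
  shows "(1 + norm x) ^ k * norm (iter_partial is \<phi> x) \<le> schwartz_seminorm k is \<phi>"
  unfolding schwartz_seminorm_def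
  by (rule cSUP_upper) (use assms in \<open>auto simp: schwartz_def\<close>)

lemma schwartz_seminorm_nonneg:
  assumes "\<phi> \<in> schwartz"
  shows "0 \<le> schwartz_seminorm k is \<phi>"
  by (rule order_trans[OF _ schwartz_seminorm_upper[OF assms, where x=0]]) simp

lemma schwartz_seminorm_least:
  assumes "\<And>x. (1 + norm x) ^ k * norm (iter_partial is \<phi> x) \<le> M"
  shows "schwartz_seminorm k is \<phi> \<le> M"
  unfolding schwartz_seminorm_def by (rule cSUP_least) (use assms in auto)

lemma schwartzI:
  assumes "smooth \<phi>" "\<And>k is. \<exists>M. \<forall>x. (1 + norm x) ^ k * norm (iter_partial is \<phi> x) \<le> M"
  shows "\<phi> \<in> schwartz"
  using assms by (fastforce simp: schwartz_def bdd_above_def)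

lemma lincomb_weighted_bound:
  assumes "\<phi> \<in> schwartz" "\<psi> \<in> schwartz"
  shows "(1 + norm x) ^ k * norm (iter_partial is (\<lambda>x. a * \<phi> x + b * \<psi> x) x)
      \<le> norm a * schwartz_seminorm k is \<phi> + norm b * schwartz_seminorm k is \<psi>"
proof -
  have "(1 + norm x) ^ k * norm (iter_partial is (\<lambda>x. a * \<phi> x + b * \<psi> x) x)
      \<le> (1 + norm x) ^ k * (norm a * norm (iter_partial is \<phi> x) + norm b * norm (iter_partial is \<psi> x))"
    unfolding iter_partial_lincomb[OF assms[THEN schwartz_imp_smooth]]
    by (intro mult_left_mono norm_triangle_le) (simp_all add: norm_mult)
  also have "\<dots> = norm a * ((1 + norm x) ^ k * norm (iter_partial is \<phi> x))
      + norm b * ((1 + norm x) ^ k * norm (iter_partial is \<psi> x))"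
    by (simp add: algebra_simps)
  also have "\<dots> \<le> norm a * schwartz_seminorm k is \<phi> + norm b * schwartz_seminorm k is \<psi>"
    by (intro add_mono mult_left_mono schwartz_seminorm_upper assms) auto
  finally show ?thesis .
qed

lemma schwartz_lincomb:
  assumes "\<phi> \<in> schwartz" "\<psi> \<in> schwartz"
  shows "(\<lambda>x. a * \<phi> x + b * \<psi> x) \<in> schwartz"
  using lincomb_weighted_bound[OF assms] smooth_lincomb[OF assms[THEN schwartz_imp_smooth]]
  by (intro schwartzI) blast+

lemma schwartz_seminorm_lincomb:
  assumes "\<phi> \<in> schwartz" "\<psi> \<in> schwartz"
  shows "schwartz_seminorm k is (\<lambda>x. a * \<phi> x + b * \<psi> x)
      \<le> norm a * schwartz_seminorm k is \<phi> + norm b * schwartz_seminorm k is \<psi>"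
  by (intro schwartz_seminorm_least lincomb_weighted_bound assms)

lemma iter_partial_zero: "iter_partial is (\<lambda>x. 0) = (\<lambda>x. 0)"
  by (induction "is") (auto simp: partial_deriv_def vector_derivative_const_at)

lemma zero_in_schwartz: "(\<lambda>x. 0) \<in> schwartz"
  by (intro schwartzI) (auto simp: smooth_def iter_partial_zero)

lemma schwartz_seminorm_zero: "schwartz_seminorm k is (\<lambda>x. 0) = 0"
  by (simp add: schwartz_seminorm_def iter_partial_zero)

lemma schwartz_diff: "\<phi> \<in> schwartz \<Longrightarrow> \<psi> \<in> schwartz \<Longrightarrow> (\<lambda>x. \<phi> x - \<psi> x) \<in> schwartz"
  using schwartz_lincomb[of \<phi> \<psi> 1 "-1"] by simp

lemma schwartz_scale: "\<phi> \<in> schwartz \<Longrightarrow> (\<lambda>x. c * \<phi> x) \<in> schwartz"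
  using schwartz_lincomb[of \<phi> "\<lambda>x. 0" c 0] zero_in_schwartz by simp

lemma schwartz_seminorm_scale:
  "\<phi> \<in> schwartz \<Longrightarrow> schwartz_seminorm k is (\<lambda>x. c * \<phi> x) \<le> norm c * schwartz_seminorm k is \<phi>"
  using schwartz_seminorm_lincomb[of \<phi> "\<lambda>x. 0" k "is" c 0] zero_in_schwartz by simp

lemma schwartz_seminorm_triangle:
  assumes "\<phi> \<in> schwartz" "\<psi> \<in> schwartz" "\<theta> \<in> schwartz"
  shows "schwartz_seminorm k is (\<lambda>x. \<phi> x - \<theta> x)
    \<le> schwartz_seminorm k is (\<lambda>x. \<phi> x - \<psi> x) + schwartz_seminorm k is (\<lambda>x. \<psi> x - \<theta> x)"
  using schwartz_seminorm_lincomb[OF schwartz_diff[OF assms(1,2)] schwartz_diff[OF assms(2,3)], of k "is" 1 1]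
  by simp

lemma schwartz_seminorm_mono:
  assumes "\<phi> \<in> schwartz" "k \<le> l"
  shows "schwartz_seminorm k is \<phi> \<le> schwartz_seminorm l is \<phi>"
proof (rule schwartz_seminorm_least)
  fix x
  have "(1 + norm x) ^ k * norm (iter_partial is \<phi> x) \<le> (1 + norm x) ^ l * norm (iter_partial is \<phi> x)"
    by (intro mult_right_mono power_increasing assms) auto
  then show "(1 + norm x) ^ k * norm (iter_partial is \<phi> x) \<le> schwartz_seminorm l is \<phi>"
    using schwartz_seminorm_upper[OF assms(1), of x l "is"] by linarith
qed

section \<open>An increasing sequence of norms generating the Schwartz topology\<close>

definition short_lists :: "nat \<Rightarrow> 'n::finite list set" where
  "short_lists N = {is. length is \<le> N}"

lemma finite_short_lists [simp]: "finite (short_lists N :: 'n::finite list set)"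
  using finite_lists_length_le[of "UNIV :: 'n set" N] by (simp add: short_lists_def)

text \<open>The same \<open>N\<close> bounds the order of differentiation and serves as the weight
  exponent. The norms increase with \<open>N\<close>, so one of them dominates any finite set of
  seminorms and continuity becomes a single inequality.\<close>

definition schwartz_norm :: "nat \<Rightarrow> (real^'n::finite \<Rightarrow> complex) \<Rightarrow> real" where
  "schwartz_norm N \<phi> = (\<Sum>is\<in>short_lists N. schwartz_seminorm N is \<phi>)"

lemma schwartz_norm_nonneg: "\<phi> \<in> schwartz \<Longrightarrow> 0 \<le> schwartz_norm N \<phi>"
  unfolding schwartz_norm_def by (intro sum_nonneg schwartz_seminorm_nonneg)

lemma schwartz_norm_mono:
  assumes "\<phi> \<in> schwartz" "M \<le> N"
  shows "schwartz_norm M \<phi> \<le> schwartz_norm N \<phi>"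
proof -
  have "schwartz_norm M \<phi> \<le> (\<Sum>is\<in>short_lists M. schwartz_seminorm N is \<phi>)"
    unfolding schwartz_norm_def by (intro sum_mono schwartz_seminorm_mono assms)
  also have "\<dots> \<le> schwartz_norm N \<phi>"
    unfolding schwartz_norm_def
    by (intro sum_mono2 schwartz_seminorm_nonneg finite_short_lists assms)
      (use assms in \<open>auto simp: short_lists_def\<close>)
  finally show ?thesis .
qed

lemma schwartz_seminorm_le_norm:
  assumes "\<phi> \<in> schwartz" "k \<le> N" "length is \<le> N"
  shows "schwartz_seminorm k is \<phi> \<le> schwartz_norm N \<phi>"
proof -
  have "schwartz_seminorm N is \<phi> \<le> schwartz_norm N \<phi>"
    unfolding schwartz_norm_def
    by (rule member_le_sum[OF _ _ finite_short_lists]) (use assms in \<open>auto simp: short_lists_def schwartz_seminorm_nonneg\<close>)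
  then show ?thesis using schwartz_seminorm_mono[OF assms(1,2), of "is"] by linarith
qed

lemma schwartz_norm_scale:
  "\<phi> \<in> schwartz \<Longrightarrow> schwartz_norm N (\<lambda>x. c * \<phi> x) \<le> norm c * schwartz_norm N \<phi>"
  unfolding schwartz_norm_def sum_distrib_left by (intro sum_mono schwartz_seminorm_scale)

text \<open>Induction on the generation of the topology: intersections take the larger index and the
  smaller radius, and a subbasic set contains a ball around each of its points by the triangle
  inequality.\<close>

lemma openin_schwartz_contains_ball:
  assumes "openin schwartz_topology U" "\<phi> \<in> U"
  shows "\<exists>N \<epsilon>. 0 < \<epsilon> \<and> (\<forall>\<psi>\<in>schwartz. schwartz_norm N (\<lambda>x. \<psi> x - \<phi> x) < \<epsilon> \<longrightarrow> \<psi> \<in> U)"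
proof -
  have "generate_topology_on {{\<psi> \<in> schwartz. schwartz_seminorm k is (\<lambda>x. \<psi> x - \<phi> x) < \<epsilon>} | k is \<phi> \<epsilon>.
        \<phi> \<in> schwartz \<and> 0 < \<epsilon>} U"
    using assms(1) unfolding schwartz_topology_def openin_topology_generated_by_iff .
  then show ?thesis using assms(2)
  proof (induction arbitrary: \<phi>)
    case (Int a b)
    obtain N \<epsilon> where 1: "0 < \<epsilon>" "\<forall>\<psi>\<in>schwartz. schwartz_norm N (\<lambda>x. \<psi> x - \<phi> x) < \<epsilon> \<longrightarrow> \<psi> \<in> a"
      using Int by blast
    obtain N' \<epsilon>' where 2: "0 < \<epsilon>'" "\<forall>\<psi>\<in>schwartz. schwartz_norm N' (\<lambda>x. \<psi> x - \<phi> x) < \<epsilon>' \<longrightarrow> \<psi> \<in> b"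
      using Int by blast
    \<comment> \<open>Places the centre \<open>\<phi>\<close> in \<open>schwartz\<close>, so that
      the difference is a Schwartz function and monotonicity of the norms applies to it.\<close>
    have "openin schwartz_topology a"
      using Int.hyps unfolding schwartz_topology_def openin_topology_generated_by_iff by blast
    then have sub: "a \<subseteq> schwartz" using openin_subset by fastforce
    have "\<psi> \<in> a \<inter> b" if "\<psi> \<in> schwartz" "schwartz_norm (max N N') (\<lambda>x. \<psi> x - \<phi> x) < min \<epsilon> \<epsilon>'" for \<psi>
    proof -
      have d: "(\<lambda>x. \<psi> x - \<phi> x) \<in> schwartz" using that Int.prems sub by (intro schwartz_diff) auto
      show ?thesis
        using 1(2)[rule_format, OF that(1)] 2(2)[rule_format, OF that(1)] that(2)
          schwartz_norm_mono[OF d, of N "max N N'"] schwartz_norm_mono[OF d, of N' "max N N'"]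
        by auto
    qed
    then show ?case using 1(1) 2(1) by (intro exI[of _ "max N N'"] exI[of _ "min \<epsilon> \<epsilon>'"]) auto
  next
    case (UN K)
    then obtain k where k: "k \<in> K" "\<phi> \<in> k" by blast
    from UN.IH[OF this] show ?case using k(1) by (meson UnionI)
  next
    case (Basis s)
    then obtain k "is" \<theta> \<epsilon> where s: "s = {\<psi> \<in> schwartz. schwartz_seminorm k is (\<lambda>x. \<psi> x - \<theta> x) < \<epsilon>}"
      "\<theta> \<in> schwartz" "0 < \<epsilon>" by blast
    \<comment> \<open>The slack left when the centre moves from \<open>\<theta>\<close> to
      \<open>\<phi>\<close>.\<close>
    define \<eta> where "\<eta> = \<epsilon> - schwartz_seminorm k is (\<lambda>x. \<phi> x - \<theta> x)"
    define N where "N = max k (length is)"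
    have \<phi>: "\<phi> \<in> schwartz" and \<eta>: "0 < \<eta>" using Basis s by (auto simp: \<eta>_def)
    have "\<psi> \<in> s" if "\<psi> \<in> schwartz" "schwartz_norm N (\<lambda>x. \<psi> x - \<phi> x) < \<eta>" for \<psi>
      using schwartz_seminorm_le_norm[OF schwartz_diff[OF that(1) \<phi>], of k N "is"]
        schwartz_seminorm_triangle[OF that(1) \<phi> s(2), of k "is"] that
      by (auto simp: s(1) N_def \<eta>_def)
    then show ?case using \<eta> by blast
  qed auto
qed

text \<open>Converse of the previous lemma: a norm ball contains a finite intersection of subbasic
  sets centred at the same point.\<close>

lemma openin_schwartzI:
  assumes sub: "W \<subseteq> schwartz"
    and ball: "\<And>\<phi>. \<phi> \<in> W \<Longrightarrow>
      \<exists>N \<epsilon>. 0 < \<epsilon> \<and> (\<forall>\<psi>\<in>schwartz. schwartz_norm N (\<lambda>x. \<psi> x - \<phi> x) < \<epsilon> \<longrightarrow> \<psi> \<in> W)"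
  shows "openin schwartz_topology W"
proof (subst openin_subopen, intro ballI)
  fix \<phi> assume "\<phi> \<in> W"
  then obtain N \<epsilon> where \<epsilon>: "0 < \<epsilon>"
    and W: "\<And>\<psi>. \<psi> \<in> schwartz \<Longrightarrow> schwartz_norm N (\<lambda>x. \<psi> x - \<phi> x) < \<epsilon> \<Longrightarrow> \<psi> \<in> W"
    using ball by blast
  have \<phi>: "\<phi> \<in> schwartz" using \<open>\<phi> \<in> W\<close> sub by blast
  define L :: "'a list set" where "L = short_lists N"
  \<comment> \<open>Distributes the radius equally over the finitely many seminorms in the sum;
    \<open>[] \<in> L\<close> makes the divisor positive and the final comparison strict.\<close>
  define \<eta> where "\<eta> = \<epsilon> / real (card L)"
  have "[] \<in> L" by (simp add: L_def short_lists_def)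
  then have L: "finite L" "L \<noteq> {}" unfolding L_def by auto
  then have \<eta>: "0 < \<eta>" using \<epsilon> by (simp add: \<eta>_def card_gt_0_iff)
  define T where "T = (\<Inter>is\<in>L. {\<psi> \<in> schwartz. schwartz_seminorm N is (\<lambda>x. \<psi> x - \<phi> x) < \<eta>})"
  have "openin schwartz_topology T"
    unfolding T_def
  proof (intro openin_Inter)
    fix S assume "S \<in> (\<lambda>is. {\<psi> \<in> schwartz. schwartz_seminorm N is (\<lambda>x. \<psi> x - \<phi> x) < \<eta>}) ` L"
    then show "openin schwartz_topology S"
      unfolding schwartz_topology_def using \<phi> \<eta> by (intro topology_generated_by_Basis) blast
  qed (use L in auto)
  moreover have "\<phi> \<in> T" using \<phi> \<eta> by (auto simp: T_def schwartz_seminorm_zero)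
  moreover have "T \<subseteq> W"
  proof
    fix \<psi> assume \<psi>: "\<psi> \<in> T"
    have "schwartz_norm N (\<lambda>x. \<psi> x - \<phi> x) < (\<Sum>is\<in>L. \<eta>)"
      unfolding schwartz_norm_def L_def[symmetric]
      by (rule sum_strict_mono) (use L \<psi> in \<open>auto simp: T_def\<close>)
    also have "\<dots> = \<epsilon>" using L \<epsilon> by (simp add: \<eta>_def)
    finally show "\<psi> \<in> W" using L \<psi> by (intro W) (auto simp: T_def)
  qed
  ultimately show "\<exists>T. openin schwartz_topology T \<and> \<phi> \<in> T \<and> T \<subseteq> W" by blast
qed

text \<open>Continuity at \<open>0\<close> makes \<open>f\<close> bounded by \<open>1\<close> on
  some norm ball; homogeneity extends this to all of \<open>schwartz\<close>.\<close>

lemma tempered_distribution_bound: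
  fixes f :: "(real^'n::finite \<Rightarrow> complex) \<Rightarrow> complex"
  assumes "tempered_distribution f"
  shows "\<exists>N C. 0 \<le> C \<and> (\<forall>\<phi>\<in>schwartz. norm (f \<phi>) \<le> C * schwartz_norm N \<phi>)"
proof -
  have hom: "f (\<lambda>x. c * \<phi> x) = c * f \<phi>" if "\<phi> \<in> schwartz" for c \<phi>
    using assms that by (simp add: tempered_distribution_def)
  have f0: "f (\<lambda>x. 0) = 0" using hom[OF zero_in_schwartz, of 0] by simp
  have op: "openin schwartz_topology {\<phi> \<in> topspace schwartz_topology. f \<phi> \<in> ball 0 1}"
    using assms by (intro openin_continuous_map_preimage[where Y=euclidean]) (auto simp: tempered_distribution_def)
  have zero: "(\<lambda>x. 0) \<in> {\<phi> \<in> topspace schwartz_topology. f \<phi> \<in> ball 0 1}"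
    using f0 zero_in_schwartz by auto
  obtain N \<epsilon> where \<epsilon>: "0 < \<epsilon>" and "\<forall>\<psi>\<in>schwartz. schwartz_norm N (\<lambda>x. \<psi> x - 0) < \<epsilon> \<longrightarrow>
      \<psi> \<in> {\<phi> \<in> topspace schwartz_topology. f \<phi> \<in> ball 0 1}"
    using openin_schwartz_contains_ball[OF op zero] by auto
  then have *: "norm (f \<psi>) < 1" if "\<psi> \<in> schwartz" "schwartz_norm N \<psi> < \<epsilon>" for \<psi>
    using that by auto
  have "norm (f \<phi>) \<le> (2 / \<epsilon>) * schwartz_norm N \<phi>" if \<phi>: "\<phi> \<in> schwartz" for \<phi>
  \<comment> \<open>The norm of \<open>\<phi>\<close> has not been shown to be positive, so it is
    enlarged to \<open>r > 0\<close> before dividing. The factor \<open>\<epsilon> / (2 * r)\<close>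
    moves \<open>\<phi>\<close> into the ball, and the enlargement costs exactly \<open>e\<close> in
    the end.\<close>
  proof (rule field_le_epsilon)
    fix e :: real assume e: "0 < e"
    define r where "r = schwartz_norm N \<phi> + e * \<epsilon> / 2"
    have r: "0 < r" using schwartz_norm_nonneg[OF \<phi>, of N] e \<epsilon> by (simp add: r_def add_nonneg_pos)
    have "schwartz_norm N (\<lambda>x. of_real (\<epsilon> / (2 * r)) * \<phi> x) \<le> (\<epsilon> / (2 * r)) * schwartz_norm N \<phi>"
      using schwartz_norm_scale[OF \<phi>, of N "of_real (\<epsilon> / (2 * r))"] \<epsilon> r by (simp add: norm_divide)
    also have "\<dots> \<le> (\<epsilon> / (2 * r)) * r"
      using \<epsilon> r e by (intro mult_left_mono) (auto simp: r_def)
    also have "\<dots> < \<epsilon>" using \<epsilon> r by simp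
    finally have "norm (f (\<lambda>x. of_real (\<epsilon> / (2 * r)) * \<phi> x)) < 1"
      by (intro * schwartz_scale \<phi>)
    then have "\<epsilon> / (2 * r) * norm (f \<phi>) < 1"
      using \<epsilon> r unfolding hom[OF \<phi>] by (simp add: norm_mult norm_divide)
    then have "norm (f \<phi>) \<le> 2 * r / \<epsilon>" using \<epsilon> r by (simp add: field_simps)
    then show "norm (f \<phi>) \<le> 2 / \<epsilon> * schwartz_norm N \<phi> + e"
      using \<epsilon> by (simp add: r_def field_simps)
  qed
  then show ?thesis using \<epsilon> by (intro exI[of _ N] exI[of _ "2 / \<epsilon>"]) auto
qed

text \<open>By additivity the bound at differences \<open>\<psi> - \<phi>\<close> is a Lipschitz
  estimate, which gives continuity at every point.\<close>

lemma tempered_distributionI: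
  fixes f :: "(real^'n::finite \<Rightarrow> complex) \<Rightarrow> complex"
  assumes add: "\<And>\<phi> \<psi>. \<phi> \<in> schwartz \<Longrightarrow> \<psi> \<in> schwartz \<Longrightarrow> f (\<lambda>x. \<phi> x + \<psi> x) = f \<phi> + f \<psi>"
    and hom: "\<And>c \<phi>. \<phi> \<in> schwartz \<Longrightarrow> f (\<lambda>x. c * \<phi> x) = c * f \<phi>"
    and bound: "\<And>\<phi>. \<phi> \<in> schwartz \<Longrightarrow> norm (f \<phi>) \<le> C * schwartz_norm N \<phi>"
  shows "tempered_distribution f"
proof -
  have "openin schwartz_topology {\<phi> \<in> schwartz. f \<phi> \<in> U}" if U: "open U" for U
  proof (rule openin_schwartzI)
    fix \<phi> assume "\<phi> \<in> {\<phi> \<in> schwartz. f \<phi> \<in> U}"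
    then have \<phi>: "\<phi> \<in> schwartz" "f \<phi> \<in> U" by auto
    then obtain e where e: "0 < e" "ball (f \<phi>) e \<subseteq> U" using U open_contains_ball by blast
    \<comment> \<open>Positive whatever the sign of \<open>C\<close>, so the radius
      \<open>e / D\<close> is legitimate.\<close>
    define D where "D = max C 1"
    have "f \<psi> \<in> U" if \<psi>: "\<psi> \<in> schwartz" "schwartz_norm N (\<lambda>x. \<psi> x - \<phi> x) < e / D" for \<psi>
    proof -
      have d: "(\<lambda>x. \<psi> x - \<phi> x) \<in> schwartz" by (intro schwartz_diff \<phi> \<psi>)
      have "f \<psi> = f \<phi> + f (\<lambda>x. \<psi> x - \<phi> x)" using add[OF \<phi>(1) d] by simp
      then have "norm (f \<psi> - f \<phi>) \<le> C * schwartz_norm N (\<lambda>x. \<psi> x - \<phi> x)" using bound[OF d] by simp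
      also have "\<dots> \<le> D * schwartz_norm N (\<lambda>x. \<psi> x - \<phi> x)"
        by (intro mult_right_mono schwartz_norm_nonneg d) (simp add: D_def)
      also have "\<dots> < e" using \<psi>(2) by (simp add: D_def field_simps)
      finally show ?thesis using e by (auto simp: dist_norm norm_minus_commute)
    qed
    moreover have "0 < e / D" using e by (simp add: D_def)
    ultimately show "\<exists>N \<epsilon>. 0 < \<epsilon> \<and> (\<forall>\<psi>\<in>schwartz. schwartz_norm N (\<lambda>x. \<psi> x - \<phi> x) < \<epsilon>
        \<longrightarrow> \<psi> \<in> {\<phi> \<in> schwartz. f \<phi> \<in> U})" by blast
  qed auto
  then have "continuous_map schwartz_topology euclidean f"
    by (auto simp: continuous_map_def)
  with add hom show ?thesis by (auto simp: tempered_distribution_def)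
qed

section \<open>Gaussian integrals\<close>

text \<open>Lebesgue measure on a Euclidean space is the image of the product of one-dimensional
  Lebesgue measures under the coordinate map, so this is Fubini for products.\<close>

lemma
  fixes g :: "'a::euclidean_space \<Rightarrow> real \<Rightarrow> 'b::{real_normed_field,banach,second_countable_topology}"
  assumes "\<And>b. b \<in> Basis \<Longrightarrow> integrable lborel (g b)"
  shows integrable_lborel_prod_Basis: "integrable lborel (\<lambda>x::'a. \<Prod>b\<in>Basis. g b (x \<bullet> b))"
    and integral_lborel_prod_Basis:
      "(\<integral>x. (\<Prod>b\<in>Basis. g b (x \<bullet> b)) \<partial>(lborel :: 'a measure)) = (\<Prod>b\<in>Basis. \<integral>x. g b x \<partial>lborel)"
proof -
  interpret product_sigma_finite "\<lambda>_::'a. lborel :: real measure" by standard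
  have [measurable]: "g b \<in> borel_measurable borel" if "b \<in> Basis" for b
    using borel_measurable_integrable[OF assms[OF that]] by simp
  have eq: "(\<Prod>b\<in>Basis. g b ((\<Sum>c\<in>Basis. f c *\<^sub>R c) \<bullet> b)) = (\<Prod>b\<in>Basis. g b (f b))" for f :: "'a \<Rightarrow> real"
    by (intro prod.cong) (auto simp: inner_sum_left inner_Basis if_distrib cong: if_cong)
  have m: "(\<lambda>f. \<Sum>c\<in>Basis. f c *\<^sub>R c) \<in> (\<Pi>\<^sub>M b\<in>Basis. lborel) \<rightarrow>\<^sub>M (borel :: 'a measure)"
    by measurable
  have m': "(\<lambda>x::'a. \<Prod>b\<in>Basis. g b (x \<bullet> b)) \<in> borel_measurable borel"
    by measurable
  have *: "(\<lambda>f. \<Prod>b\<in>Basis. g b ((\<Sum>c\<in>Basis. f c *\<^sub>R c) \<bullet> b)) = (\<lambda>f. \<Prod>b\<in>Basis. g b (f b))"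
    using eq by auto
  show "integrable lborel (\<lambda>x::'a. \<Prod>b\<in>Basis. g b (x \<bullet> b))"
    unfolding lborel_eq[where 'a='a] integrable_distr_eq[OF m m'] *
    by (intro product_integrable_prod assms) auto
  show "(\<integral>x. (\<Prod>b\<in>Basis. g b (x \<bullet> b)) \<partial>(lborel :: 'a measure)) = (\<Prod>b\<in>Basis. \<integral>x. g b x \<partial>lborel)"
    unfolding lborel_eq[where 'a='a] integral_distr[OF m m'] *
    by (intro product_integral_prod assms) auto
qed

lemma
  fixes g :: "'n::finite \<Rightarrow> real \<Rightarrow> 'b::{real_normed_field,banach,second_countable_topology}"
  assumes "\<And>i. integrable lborel (g i)"
  shows integrable_lborel_prod_vec: "integrable lborel (\<lambda>x::real^'n. \<Prod>i\<in>UNIV. g i (x $ i))"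
    and integral_lborel_prod_vec:
      "(\<integral>x. (\<Prod>i\<in>UNIV. g i (x $ i)) \<partial>(lborel :: (real^'n) measure)) = (\<Prod>i\<in>UNIV. \<integral>x. g i x \<partial>lborel)"
proof -
  \<comment> \<open>Reindexes the factors from coordinates to basis vectors; the choice is unique on
    \<open>Basis\<close> because \<open>axis\<close> is injective in its index.\<close>
  define h where "h b = g (SOME i. b = axis i (1::real))" for b :: "real^'n"
  have h: "h (axis i 1) = g i" for i
    unfolding h_def by (simp add: axis_eq_axis)
  have B: "(Basis :: (real^'n) set) = range (\<lambda>i. axis i 1)"
    by (auto simp: Basis_vec_def)
  have inj: "inj (\<lambda>i::'n. axis i (1::real))" by (auto simp: inj_on_def axis_eq_axis)
  have 1: "(\<Prod>b\<in>Basis. h b (x \<bullet> b)) = (\<Prod>i\<in>UNIV. g i (x $ i))" for x :: "real^'n"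
    unfolding B by (subst prod.reindex[OF inj]) (simp add: h inner_axis)
  have 2: "(\<Prod>b\<in>Basis. \<integral>x. h b x \<partial>lborel) = (\<Prod>i\<in>UNIV. \<integral>x. g i x \<partial>lborel)"
    unfolding B by (subst prod.reindex[OF inj]) (simp add: h)
  have "integrable lborel (h b)" if "b \<in> Basis" for b
    using assms by (simp add: h_def)
  note integrable_lborel_prod_Basis[of h, OF this] integral_lborel_prod_Basis[of h, OF this]
  then show "integrable lborel (\<lambda>x::real^'n. \<Prod>i\<in>UNIV. g i (x $ i))"
    "(\<integral>x. (\<Prod>i\<in>UNIV. g i (x $ i)) \<partial>(lborel :: (real^'n) measure)) = (\<Prod>i\<in>UNIV. \<integral>x. g i x \<partial>lborel)"
    unfolding 1 2 by auto
qed

lemma norm_sq_Basis: "(norm x)\<^sup>2 = (\<Sum>b\<in>Basis. (x \<bullet> b)\<^sup>2)" for x :: "'a::euclidean_space"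
  by (simp only: power2_norm_eq_inner euclidean_inner[of x x]) (simp add: power2_eq_square)

text \<open>The substitution \<open>sqrt (2 * a) * x\<close> in the standard normal density.\<close>

lemma integrable_exp_neg_sq_real:
  assumes "a > 0"
  shows "integrable lborel (\<lambda>x::real. exp (- a * x\<^sup>2))"
proof -
  have "integrable lborel (\<lambda>x::real. std_normal_density (0 + sqrt (2 * a) * x))"
    using assms by (intro lborel_integrable_real_affine integrable_normal_density[where \<mu>=0 and \<sigma>=1]) auto
  then have "integrable lborel (\<lambda>x::real. sqrt (2 * pi) * std_normal_density (0 + sqrt (2 * a) * x))"
    by (rule integrable_mult_right)
  then show ?thesis using assms by (simp add: std_normal_density_def power_mult_distrib)
qed

lemma integrable_exp_neg_norm_sq:
  assumes "a > 0"
  shows "integrable lborel (\<lambda>x::'a::euclidean_space. exp (- a * (norm x)\<^sup>2))"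
proof -
  have "integrable lborel (\<lambda>x::'a. \<Prod>b\<in>Basis. exp (- a * (x \<bullet> b)\<^sup>2))"
    using integrable_exp_neg_sq_real[OF assms] by (rule integrable_lborel_prod_Basis)
  then show ?thesis
    by (simp add: norm_sq_Basis sum_distrib_left exp_sum)
qed

lemma integrable_inverse_one_plus_sq: "integrable lborel (\<lambda>x::real. inverse (1 + x\<^sup>2))"
  using integrable_inverse_1_plus_square by (simp add: set_integrable_def einterval_def)

text \<open>Each factor \<open>1 + (norm x)\<^sup>2\<close> is at least
  \<open>1 + (x \<bullet> b)\<^sup>2\<close>; spending one factor on each basis vector gives a
  dominating product of integrable functions of one variable.\<close>

lemma integrable_inverse_power_norm:
  "integrable lborel (\<lambda>x::'a::euclidean_space. inverse ((1 + (norm x)\<^sup>2) ^ DIM('a)))"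
proof (rule Bochner_Integration.integrable_bound)
  show "integrable lborel (\<lambda>x::'a. \<Prod>b\<in>Basis. inverse (1 + (x \<bullet> b)\<^sup>2))"
    using integrable_inverse_one_plus_sq by (rule integrable_lborel_prod_Basis)
  have "inverse ((1 + (norm x)\<^sup>2) ^ DIM('a)) \<le> (\<Prod>b\<in>Basis. inverse (1 + (x \<bullet> b)\<^sup>2))" for x :: 'a
  proof -
    have "inverse ((1 + (norm x)\<^sup>2) ^ DIM('a)) = (\<Prod>b\<in>(Basis::'a set). inverse (1 + (norm x)\<^sup>2))"
      by (simp add: power_inverse)
    also have "\<dots> \<le> (\<Prod>b\<in>Basis. inverse (1 + (x \<bullet> b)\<^sup>2))"
      by (intro prod_mono conjI le_imp_inverse_le)
        (auto simp: Basis_le_norm abs_le_square_iff[symmetric] add_pos_nonneg)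
    finally show ?thesis .
  qed
  then show "AE x::'a in lborel. norm (inverse ((1 + (norm x)\<^sup>2) ^ DIM('a)))
      \<le> norm (\<Prod>b\<in>Basis. inverse (1 + (x \<bullet> b)\<^sup>2))"
    by (intro AE_I2) (auto simp: abs_of_nonneg prod_nonneg)
qed measurable

section \<open>Gaussian integrals with a complex linear term\<close>

text \<open>Follows from the characteristic function of the standard normal distribution: the
  imaginary part of \<open>b\<close> becomes the frequency, the real part a shift of the
  variable.\<close>

lemma gaussian_integral_complex_real:
  fixes b :: complex and a :: real
  assumes "a > 0"
  shows "has_bochner_integral lborel (\<lambda>x::real. exp (- of_real a * (of_real x)\<^sup>2 + b * of_real x))
    (of_real (sqrt (pi / a)) * exp (b\<^sup>2 / (4 * of_real a)))"
proof -
  define r where "r = sqrt (2 * a)"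
  have r: "r > 0" "r\<^sup>2 = 2 * a" using assms by (auto simp: r_def)
  define p q where "p = Re b" and "q = Im b"
  have b: "b = of_real p + \<i> * of_real q" by (simp add: p_def q_def complex_eq_iff)
  have "integral\<^sup>L std_normal_distribution (\<lambda>x. iexp (q / r * x)) = of_real (exp (- (q / r)\<^sup>2 / 2))"
    using fun_cong[OF char_std_normal_distribution, of "q / r"] unfolding char_def .
  then have I: "(\<integral>x. std_normal_density x *\<^sub>R iexp (q / r * x) \<partial>lborel) = of_real (exp (- (q / r)\<^sup>2 / 2))"
    by (subst (asm) integral_density) auto
  have int: "integrable lborel (\<lambda>x. std_normal_density x *\<^sub>R iexp (q / r * x))"
    by (rule Bochner_Integration.integrable_bound[OF integrable_normal_density[where \<mu>=0 and \<sigma>=1]]) auto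
  have hb: "has_bochner_integral lborel (\<lambda>x. std_normal_density x *\<^sub>R iexp (q / r * x)) (of_real (exp (- (q / r)\<^sup>2 / 2)))"
    using I int by (simp add: has_bochner_integral_iff)
  have hb2: "has_bochner_integral lborel (\<lambda>x. std_normal_density (- p / r + r * x) *\<^sub>R iexp (q / r * (- p / r + r * x)))
      (of_real (exp (- (q / r)\<^sup>2 / 2)) /\<^sub>R \<bar>r\<bar>)"
    using hb r by (subst (asm) lborel_has_bochner_integral_real_affine_iff[of r _ _ "- p / r"]) auto
  \<comment> \<open>Undoes the normalisation of the density and the constant modulus and phase
    created by the shift \<open>- p / r\<close>.\<close>
  define k where "k = of_real (sqrt (2 * pi)) * exp (of_real (p\<^sup>2 / (4 * a)) + \<i> * of_real (q * p / (2 * a)))"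
  have "has_bochner_integral lborel (\<lambda>x. k * (std_normal_density (- p / r + r * x) *\<^sub>R iexp (q / r * (- p / r + r * x))))
      (k * (of_real (exp (- (q / r)\<^sup>2 / 2)) /\<^sub>R \<bar>r\<bar>))"
    using hb2 by (rule has_bochner_integral_mult_right)
  moreover have "k * (std_normal_density (- p / r + r * x) *\<^sub>R iexp (q / r * (- p / r + r * x)))
      = exp (- of_real a * (of_real x)\<^sup>2 + b * of_real x)" for x
  proof -
    have "(- p / r + r * x)\<^sup>2 = p\<^sup>2 / r\<^sup>2 - 2 * p * x + r\<^sup>2 * x\<^sup>2"
      using r(1) by (simp add: power2_eq_square field_simps)
    then have 1: "- (- p / r + r * x)\<^sup>2 / 2 = - (p\<^sup>2 / (4 * a)) + p * x - a * x\<^sup>2"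
      unfolding r(2) using assms by (simp add: field_simps)
    have "q / r * (- p / r + r * x) = - (q * p / r\<^sup>2) + q * x"
      using r(1) by (simp add: power2_eq_square field_simps)
    then have 2: "q / r * (- p / r + r * x) = - (q * p / (2 * a)) + q * x"
      unfolding r(2) .
    have 3: "of_real (p\<^sup>2 / (4 * a)) + \<i> * of_real (q * p / (2 * a)) + of_real (- (- p / r + r * x)\<^sup>2 / 2)
        + \<i> * of_real (q / r * (- p / r + r * x)) = - of_real a * (of_real x)\<^sup>2 + b * of_real x"
      unfolding 1 2 by (simp add: b algebra_simps)
    have "k * (std_normal_density (- p / r + r * x) *\<^sub>R iexp (q / r * (- p / r + r * x)))
      = exp (of_real (p\<^sup>2 / (4 * a)) + \<i> * of_real (q * p / (2 * a))) * exp (of_real (- (- p / r + r * x)\<^sup>2 / 2))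
        * exp (\<i> * of_real (q / r * (- p / r + r * x)))"
      unfolding k_def std_normal_density_def exp_of_real by (simp add: scaleR_conv_of_real mult_ac)
    also have "\<dots> = exp (- of_real a * (of_real x)\<^sup>2 + b * of_real x)"
      unfolding exp_add[symmetric] 3 ..
    finally show ?thesis .
  qed
  moreover have "k * (of_real (exp (- (q / r)\<^sup>2 / 2)) /\<^sub>R \<bar>r\<bar>) = of_real (sqrt (pi / a)) * exp (b\<^sup>2 / (4 * of_real a))"
  proof -
    have 1: "sqrt (pi / a) = sqrt (2 * pi) / r"
      unfolding r_def by (simp add: real_sqrt_divide[symmetric])
    have "- (q / r)\<^sup>2 / 2 = - (q\<^sup>2 / (4 * a))" by (simp add: power_divide r)
    moreover have "of_real (p\<^sup>2 / (4 * a)) + \<i> * of_real (q * p / (2 * a)) + of_real (- (q\<^sup>2 / (4 * a))) = b\<^sup>2 / (4 * of_real a)"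
      using assms by (simp add: b power2_eq_square field_simps)
    ultimately have 2: "of_real (p\<^sup>2 / (4 * a)) + \<i> * of_real (q * p / (2 * a)) + of_real (- (q / r)\<^sup>2 / 2) = b\<^sup>2 / (4 * of_real a)"
      by simp
    have "k * (of_real (exp (- (q / r)\<^sup>2 / 2)) /\<^sub>R \<bar>r\<bar>) = of_real (sqrt (2 * pi) / r) *
      (exp (of_real (p\<^sup>2 / (4 * a)) + \<i> * of_real (q * p / (2 * a))) * exp (of_real (- (q / r)\<^sup>2 / 2)))"
      using r unfolding k_def exp_of_real by (simp add: scaleR_conv_of_real field_simps)
    then show ?thesis unfolding exp_add[symmetric] 1 2 .
  qed
  ultimately show ?thesis by simp
qed

lemma gaussian_integral_complex_vec:
  fixes b :: "complex^'n::finite" and a :: real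
  assumes "a > 0"
  shows "integrable lborel (\<lambda>u::real^'n. exp (- of_real a * (\<Sum>i\<in>UNIV. (of_real (u $ i))\<^sup>2) + (\<Sum>i\<in>UNIV. b $ i * of_real (u $ i))))"
    and "(\<integral>u. exp (- of_real a * (\<Sum>i\<in>UNIV. (of_real (u $ i))\<^sup>2) + (\<Sum>i\<in>UNIV. b $ i * of_real (u $ i))) \<partial>(lborel :: (real^'n) measure))
      = of_real (sqrt (pi / a) ^ CARD('n)) * exp ((\<Sum>i\<in>UNIV. (b $ i)\<^sup>2) / (4 * of_real a))"
proof -
  have eq: "exp (- of_real a * (\<Sum>i\<in>UNIV. (of_real (u $ i))\<^sup>2) + (\<Sum>i\<in>UNIV. b $ i * of_real (u $ i)))
    = (\<Prod>i\<in>UNIV. exp (- of_real a * (of_real (u $ i))\<^sup>2 + b $ i * of_real (u $ i)))" for u :: "real^'n"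
    by (simp only: exp_sum[symmetric] finite sum.distrib sum_distrib_left)
  have g: "integrable lborel (\<lambda>x::real. exp (- of_real a * (of_real x)\<^sup>2 + b $ i * of_real x))"
    "(\<integral>x. exp (- of_real a * (of_real x)\<^sup>2 + b $ i * of_real x) \<partial>lborel)
       = of_real (sqrt (pi / a)) * exp ((b $ i)\<^sup>2 / (4 * of_real a))" for i
    using gaussian_integral_complex_real[OF assms, of "b $ i"] by (auto simp: has_bochner_integral_iff)
  show "integrable lborel (\<lambda>u::real^'n. exp (- of_real a * (\<Sum>i\<in>UNIV. (of_real (u $ i))\<^sup>2) + (\<Sum>i\<in>UNIV. b $ i * of_real (u $ i))))"
    unfolding eq using g(1) by (rule integrable_lborel_prod_vec)
  show "(\<integral>u. exp (- of_real a * (\<Sum>i\<in>UNIV. (of_real (u $ i))\<^sup>2) + (\<Sum>i\<in>UNIV. b $ i * of_real (u $ i))) \<partial>(lborel :: (real^'n) measure))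
      = of_real (sqrt (pi / a) ^ CARD('n)) * exp ((\<Sum>i\<in>UNIV. (b $ i)\<^sup>2) / (4 * of_real a))"
    unfolding eq
    by (subst integral_lborel_prod_vec[OF g(1)]) (simp only: g(2), simp add: prod.distrib exp_sum sum_divide_distrib)
qed

section \<open>Invariance of Lebesgue measure\<close>

lemma lborel_integral_translation:
  fixes f :: "'a::euclidean_space \<Rightarrow> 'b::{banach,second_countable_topology}"
  assumes "f \<in> borel_measurable borel"
  shows "(\<integral>x. f (x + c) \<partial>lborel) = (\<integral>x. f x \<partial>lborel)"
    and "integrable lborel (\<lambda>x. f (x + c)) \<longleftrightarrow> integrable lborel f"
proof -
  have m: "(+) c \<in> lborel \<rightarrow>\<^sub>M borel" by simp
  show "(\<integral>x. f (x + c) \<partial>lborel) = (\<integral>x. f x \<partial>lborel)"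
    by (subst (2) lborel_distr_plus[symmetric, of c]) (simp add: integral_distr[OF m assms] add.commute)
  show "integrable lborel (\<lambda>x. f (x + c)) \<longleftrightarrow> integrable lborel f"
    by (subst (2) lborel_distr_plus[symmetric, of c]) (simp add: integrable_distr_eq[OF m assms] add.commute)
qed

section \<open>Shears and rotations of a product space\<close>

definition lborel_preserving :: "('a::euclidean_space \<Rightarrow> 'a) \<Rightarrow> bool" where
  "lborel_preserving T \<longleftrightarrow> T \<in> borel \<rightarrow>\<^sub>M borel \<and> distr lborel borel T = lborel"

lemma lborel_preserving_comp:
  assumes "lborel_preserving S" "lborel_preserving T"
  shows "lborel_preserving (\<lambda>x. S (T x))"
proof -
  have [measurable]: "S \<in> borel \<rightarrow>\<^sub>M borel" "T \<in> borel \<rightarrow>\<^sub>M borel"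
    using assms by (auto simp: lborel_preserving_def)
  have "distr lborel borel (\<lambda>x. S (T x)) = distr (distr lborel borel T) borel S"
    by (subst distr_distr) (auto simp: comp_def)
  then show ?thesis using assms by (simp add: lborel_preserving_def)
qed

text \<open>For fixed second coordinate \<open>y\<close> the map translates by
  \<open>a *\<^sub>R y\<close>; Fubini reduces the claim to translation invariance on each
  slice.\<close>

lemma lborel_preserving_shear:
  "lborel_preserving (\<lambda>z :: 'a::euclidean_space \<times> 'a. (fst z + a *\<^sub>R snd z, snd z))"
  unfolding lborel_preserving_def
proof
  let ?T = "\<lambda>z :: 'a \<times> 'a. (fst z + a *\<^sub>R snd z, snd z)"
  show T: "?T \<in> borel \<rightarrow>\<^sub>M borel"
    by (intro borel_measurable_continuous_onI continuous_intros)
  show "distr lborel borel ?T = lborel"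
  proof (rule measure_eqI)
    fix A assume "A \<in> sets (distr lborel borel ?T)"
    then have A: "A \<in> sets borel" by simp
    have A': "A \<in> sets (lborel \<Otimes>\<^sub>M lborel)" using A unfolding lborel_prod by simp
    have tr: "(\<integral>\<^sup>+x. indicator A (x + c, y) \<partial>lborel) = (\<integral>\<^sup>+x. indicator A (x, y) \<partial>(lborel :: 'a measure))" for c y
    proof -
      have m: "(\<lambda>x. indicator A (x, y) :: ennreal) \<in> borel_measurable borel"
        using A' by measurable
      show ?thesis
        by (subst (2) lborel_distr_plus[symmetric, of c]) (use m in \<open>simp add: nn_integral_distr add.commute\<close>)
    qed
    have m1: "(\<lambda>z. indicator A z :: ennreal) \<in> borel_measurable (lborel \<Otimes>\<^sub>M lborel)" using A' by measurable
    have m2: "(\<lambda>z. indicator A (?T z) :: ennreal) \<in> borel_measurable (lborel \<Otimes>\<^sub>M lborel)"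
      unfolding lborel_prod using T A by simp
    have "emeasure (distr lborel borel ?T) A = (\<integral>\<^sup>+z. indicator A z \<partial>distr lborel borel ?T)"
      using A by simp
    also have "\<dots> = (\<integral>\<^sup>+z. indicator A (?T z) \<partial>(lborel \<Otimes>\<^sub>M lborel))"
      unfolding lborel_prod by (rule nn_integral_distr) (use T A in auto)
    also have "\<dots> = (\<integral>\<^sup>+y. \<integral>\<^sup>+x. indicator A (x + a *\<^sub>R y, y) \<partial>lborel \<partial>lborel)"
      by (subst lborel_pair.nn_integral_snd[symmetric, OF m2]) simp
    also have "\<dots> = (\<integral>\<^sup>+z. indicator A z \<partial>(lborel \<Otimes>\<^sub>M lborel))"
      by (subst lborel_pair.nn_integral_snd[symmetric, OF m1]) (simp add: tr)
    also have "\<dots> = emeasure lborel A"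
      using A by (simp add: lborel_prod)
    finally show "emeasure (distr lborel borel ?T) A = emeasure lborel A" .
  qed simp
qed

lemma lborel_preserving_swap:
  "lborel_preserving (\<lambda>z :: 'a::euclidean_space \<times> 'a. (snd z, fst z))"
proof -
  have "distr (lborel \<Otimes>\<^sub>M lborel) (lborel \<Otimes>\<^sub>M lborel) (\<lambda>(x, y). (y, x)) = (lborel \<Otimes>\<^sub>M lborel :: ('a \<times> 'a) measure)"
    using lborel_pair.distr_pair_swap[where 'a='a and 'b='a] by simp
  then have "distr lborel borel (\<lambda>z :: 'a \<times> 'a. (snd z, fst z)) = lborel"
    unfolding lborel_prod case_prod_beta' by (simp cong: distr_cong)
  moreover have "(\<lambda>z :: 'a \<times> 'a. (snd z, fst z)) \<in> borel \<rightarrow>\<^sub>M borel"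
    by (intro borel_measurable_continuous_onI continuous_intros)
  ultimately show ?thesis by (simp add: lborel_preserving_def)
qed

lemma lborel_preserving_shear':
  "lborel_preserving (\<lambda>z :: 'a::euclidean_space \<times> 'a. (fst z, snd z + a *\<^sub>R fst z))"
  using lborel_preserving_comp[OF lborel_preserving_swap
      lborel_preserving_comp[OF lborel_preserving_shear[of a] lborel_preserving_swap]] by simp

text \<open>A rotation by an angle other than \<open>\<pi>\<close> is a product of three shears.\<close>

lemma lborel_preserving_rotation:
  fixes c s :: real
  assumes cs: "c\<^sup>2 + s\<^sup>2 = 1"
  shows "lborel_preserving (\<lambda>z :: 'a::euclidean_space \<times> 'a. (c *\<^sub>R fst z - s *\<^sub>R snd z, s *\<^sub>R fst z + c *\<^sub>R snd z))"
proof -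
  have gen: "lborel_preserving (\<lambda>z :: 'a \<times> 'a. (c *\<^sub>R fst z - s *\<^sub>R snd z, s *\<^sub>R fst z + c *\<^sub>R snd z))"
    if cs: "c\<^sup>2 + s\<^sup>2 = 1" and c: "c \<noteq> -1" for c s
  proof -
    \<comment> \<open>For \<open>c = cos \<theta>\<close> and \<open>s = sin \<theta>\<close> this
      is \<open>- tan (\<theta> / 2)\<close>; the factorisation is shear by \<open>a\<close>,
      transposed shear by \<open>s\<close>, shear by \<open>a\<close>.\<close>
    define a where "a = - s / (1 + c)"
    have c0: "1 + c \<noteq> 0" using c by linarith
    have "(1 - c) * (1 + c) = s * s" using cs by (simp add: power2_eq_square algebra_simps)
    then have 1: "1 + a * s = c" using c0 by (simp add: a_def field_simps)
    have "a * (1 + c) = - s" using c0 by (simp add: a_def)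
    then have 2: "a + c * a = - s" by (simp add: algebra_simps)
    have 3: "1 + s * a = c" using 1 by (simp add: mult.commute)
    have "(\<lambda>z :: 'a \<times> 'a. (c *\<^sub>R fst z - s *\<^sub>R snd z, s *\<^sub>R fst z + c *\<^sub>R snd z)) =
       (\<lambda>z. (\<lambda>z. (fst z + a *\<^sub>R snd z, snd z)) ((\<lambda>z. (fst z, snd z + s *\<^sub>R fst z))
         ((\<lambda>z. (fst z + a *\<^sub>R snd z, snd z)) z)))"
    proof (rule ext)
      fix z :: "'a \<times> 'a"
      have e1: "c *\<^sub>R fst z = fst z + (a * s) *\<^sub>R fst z"
        unfolding 1[symmetric] by (simp add: scaleR_add_left)
      have "s = - (a + (a + a * s * a))" using 2 unfolding 1[symmetric] by (simp add: algebra_simps)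
      then have e2: "s *\<^sub>R snd z = - (a *\<^sub>R snd z + (a *\<^sub>R snd z + (a * s * a) *\<^sub>R snd z))"
        by (metis scaleR_add_left scaleR_minus_left)
      have A: "fst z + a *\<^sub>R snd z + a *\<^sub>R (snd z + s *\<^sub>R (fst z + a *\<^sub>R snd z)) = c *\<^sub>R fst z - s *\<^sub>R snd z"
        unfolding e1 by (subst e2) (simp add: scaleR_add_right mult.assoc)
      have "snd z + s *\<^sub>R (fst z + a *\<^sub>R snd z) = s *\<^sub>R fst z + (1 + s * a) *\<^sub>R snd z"
        by (simp add: algebra_simps)
      then have B: "snd z + s *\<^sub>R (fst z + a *\<^sub>R snd z) = s *\<^sub>R fst z + c *\<^sub>R snd z" unfolding 3 .
      show "(c *\<^sub>R fst z - s *\<^sub>R snd z, s *\<^sub>R fst z + c *\<^sub>R snd z) =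
        (\<lambda>z. (fst z + a *\<^sub>R snd z, snd z)) ((\<lambda>z. (fst z, snd z + s *\<^sub>R fst z))
         ((\<lambda>z. (fst z + a *\<^sub>R snd z, snd z)) z))"
        using A B by simp
    qed
    then show ?thesis
      using lborel_preserving_comp[OF lborel_preserving_shear[of a]
          lborel_preserving_comp[OF lborel_preserving_shear'[of s] lborel_preserving_shear[of a]]]
      by simp
  qed
  show ?thesis
  proof (cases "c = -1")
    case True
    then have "s = 0" using cs by simp
    \<comment> \<open>Rotation by \<open>\<pi>\<close> is the square of the quarter turn, to which
      the generic case applies.\<close>
    then show ?thesis
      using lborel_preserving_comp[OF gen[of 0 1] gen[of 0 1]] True by simp
  qed (use gen cs in blast)
qed

lemma lborel_preserving_integral:
  fixes f :: "'a::euclidean_space \<Rightarrow> 'b::{banach,second_countable_topology}"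
  assumes "lborel_preserving T" "f \<in> borel_measurable borel"
  shows "(\<integral>x. f (T x) \<partial>lborel) = (\<integral>x. f x \<partial>lborel)"
    and "integrable lborel (\<lambda>x. f (T x)) \<longleftrightarrow> integrable lborel f"
proof -
  have T: "T \<in> lborel \<rightarrow>\<^sub>M borel" "distr lborel borel T = lborel" using assms by (auto simp: lborel_preserving_def)
  show "(\<integral>x. f (T x) \<partial>lborel) = (\<integral>x. f x \<partial>lborel)"
    using integral_distr[OF T(1) assms(2)] T(2) by simp
  show "integrable lborel (\<lambda>x. f (T x)) \<longleftrightarrow> integrable lborel f"
    using integrable_distr_eq[OF T(1) assms(2)] T(2) by simp
qed

section \<open>Averages over a parameter in the unit interval\<close>

text \<open>Supplies the Fubini hypothesis for both averaging arguments below, over translations and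
  over rotations: a uniform bound on the \<open>L\<^sup>1\<close> norms is integrable over a
  parameter range of length one.\<close>

lemma integrable_unit_interval_product:
  fixes f :: "real \<Rightarrow> 'a::euclidean_space \<Rightarrow> complex"
  assumes cont: "continuous_on UNIV (\<lambda>(s, x). f s x)"
    and int: "\<And>s. integrable lborel (f s)"
    and bound: "\<And>s. (\<integral>x. norm (f s x) \<partial>lborel) \<le> C"
  shows "integrable (lborel \<Otimes>\<^sub>M lborel) (\<lambda>(s, x). indicat_real {0..1} s *\<^sub>R f s x)"
proof (rule lborel_pair.Fubini_integrable)
  have [measurable]: "(\<lambda>(s, x). f s x) \<in> borel_measurable borel"
    using cont by (rule borel_measurable_continuous_onI)
  then have [measurable]: "(\<lambda>(s, x). f s x) \<in> borel_measurable (lborel \<Otimes>\<^sub>M lborel)"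
    by (simp add: lborel_prod)
  show m: "(\<lambda>(s, x). indicat_real {0..1} s *\<^sub>R f s x) \<in> borel_measurable (lborel \<Otimes>\<^sub>M lborel)"
    by measurable
  have "(\<lambda>s. \<integral>x. norm (case (s, x) of (s, x) \<Rightarrow> indicat_real {0..1} s *\<^sub>R f s x) \<partial>lborel) \<in> borel_measurable lborel"
    using m by measurable
  show "integrable lborel (\<lambda>s. \<integral>x. norm (case (s, x) of (s, x) \<Rightarrow> indicat_real {0..1} s *\<^sub>R f s x) \<partial>lborel)"
  proof (rule Bochner_Integration.integrable_bound)
    show "integrable lborel (\<lambda>s::real. C * indicat_real {0..1} s)"
      by (intro integrable_mult_right integrable_real_indicator) auto
    show "AE s in lborel. norm (\<integral>x. norm (case (s, x) of (s, x) \<Rightarrow> indicat_real {0..1} s *\<^sub>R f s x) \<partial>lborel)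
        \<le> norm (C * indicat_real {0..1} s)"
    proof (intro AE_I2)
      fix s
      have "0 \<le> (\<integral>x. norm (f s x) \<partial>lborel)" by simp
      then show "norm (\<integral>x. norm (case (s, x) of (s, x) \<Rightarrow> indicat_real {0..1} s *\<^sub>R f s x) \<partial>lborel)
        \<le> norm (C * indicat_real {0..1} s)"
        using bound[of s] abs_ge_self[of C] by (auto simp: abs_mult indicator_def)
    qed
  qed fact
  show "AE s in lborel. integrable lborel (\<lambda>x. case (s, x) of (s, x) \<Rightarrow> indicat_real {0..1} s *\<^sub>R f s x)"
    using int by (intro AE_I2) auto
qed

text \<open>Integration by parts without boundary terms. The integral of
  \<open>\<psi> (x + e) - \<psi> x\<close> vanishes by translation invariance; by the fundamental
  theorem and Fubini it is also the average over \<open>s\<close> of the integrals of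
  \<open>D (x + s *\<^sub>R e)\<close>, each equal to the integral of \<open>D\<close>.\<close>

lemma integral_directional_derivative_eq_0:
  fixes \<psi> D :: "'a::euclidean_space \<Rightarrow> complex"
  assumes deriv: "\<And>x. ((\<lambda>h. \<psi> (x + h *\<^sub>R e)) has_vector_derivative D x) (at 0)"
    and cont: "continuous_on UNIV D"
    and int: "integrable lborel \<psi>" "integrable lborel D"
  shows "(\<integral>x. D x \<partial>lborel) = 0"
proof -
  have Dm: "D \<in> borel_measurable borel" "(\<lambda>x. norm (D x)) \<in> borel_measurable borel"
    using cont by (auto intro: borel_measurable_continuous_onI continuous_intros)
  have \<psi>m: "\<psi> \<in> borel_measurable borel" using int by auto
  have d: "((\<lambda>h. \<psi> (x + h *\<^sub>R e)) has_vector_derivative D (x + s *\<^sub>R e)) (at s within A)" for x s A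
  proof -
    have "((\<lambda>h. \<psi> (x + s *\<^sub>R e + h *\<^sub>R e)) \<circ> (\<lambda>h. h - s) has_vector_derivative 1 *\<^sub>R D (x + s *\<^sub>R e)) (at s)"
      by (rule vector_diff_chain_at) (use deriv in \<open>auto intro!: derivative_eq_intros\<close>)
    then show ?thesis by (auto simp: o_def algebra_simps intro: has_vector_derivative_at_within)
  qed
  have c: "continuous_on UNIV (\<lambda>(s, x). D (x + s *\<^sub>R e))"
    by (auto simp: case_prod_beta' intro!: continuous_intros continuous_on_compose2[OF cont])
  have "(\<integral>s. (\<integral>x. indicat_real {0..1} s *\<^sub>R D (x + s *\<^sub>R e) \<partial>lborel) \<partial>lborel)
      = (\<integral>x. (\<integral>s. indicat_real {0..1} s *\<^sub>R D (x + s *\<^sub>R e) \<partial>lborel) \<partial>lborel)"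
    by (rule lborel_pair.Fubini_integral[symmetric],
        rule integrable_unit_interval_product[OF c, of "\<integral>x. norm (D x) \<partial>lborel"])
       (use int Dm in \<open>auto simp: lborel_integral_translation[of D] lborel_integral_translation[of "\<lambda>x. norm (D x)"]\<close>)
  also have "\<dots> = (\<integral>x. \<psi> (x + e) - \<psi> x \<partial>lborel)"
  proof (intro Bochner_Integration.integral_cong refl)
    fix x
    have "(\<integral>s. indicat_real {0..1} s *\<^sub>R D (x + s *\<^sub>R e) \<partial>lborel) = \<psi> (x + 1 *\<^sub>R e) - \<psi> (x + 0 *\<^sub>R e)"
      by (rule integral_FTC_atLeastAtMost)
         (auto intro!: d continuous_intros continuous_on_compose2[OF cont])
    then show "(\<integral>s. indicat_real {0..1} s *\<^sub>R D (x + s *\<^sub>R e) \<partial>lborel) = \<psi> (x + e) - \<psi> x" by simp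
  qed
  also have "\<dots> = 0"
    using int \<psi>m by (subst Bochner_Integration.integral_diff) (auto simp: lborel_integral_translation[of \<psi>])
  also have "(\<integral>s. (\<integral>x. indicat_real {0..1} s *\<^sub>R D (x + s *\<^sub>R e) \<partial>lborel) \<partial>lborel)
      = (\<integral>s. indicat_real {0..1::real} s *\<^sub>R (\<integral>x. D x \<partial>lborel) \<partial>lborel)"
    using Dm by (simp add: lborel_integral_translation[of D])
  also have "\<dots> = (\<integral>x. D x \<partial>lborel)" by simp
  finally show ?thesis .
qed

section \<open>The Fock space reproducing formula\<close>

text \<open>Integrals over complex space are taken over pairs, where multiplication by a unit
  complex number is the rotation already known to preserve Lebesgue measure.\<close>

definition cpair :: "(real^'n) \<times> (real^'n) \<Rightarrow> complex^'n::finite" where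
  "cpair p = cvec (fst p) (snd p)"

lemma cvec_nth [simp]: "cvec x y $ j = Complex (x $ j) (y $ j)"
  by (simp add: cvec_def)

lemma linear_cpair: "linear cpair"
  by (intro linearI) (auto simp: cpair_def vec_eq_iff complex_eq_iff)

lemma continuous_on_cpair [continuous_intros]:
  "continuous_on S f \<Longrightarrow> continuous_on S (\<lambda>x. cpair (f x))"
  using linear_cpair unfolding linear_conv_bounded_linear by (rule bounded_linear.continuous_on)

lemma norm_cvec_sq: "(norm (cvec x y))\<^sup>2 = (norm x)\<^sup>2 + (norm y)\<^sup>2"
  by (simp only: power2_norm_eq_inner inner_vec_def) (simp add: inner_complex_def sum.distrib)

lemma norm_cpair: "norm (cpair p) = norm p"
proof (rule power2_eq_imp_eq)
  show "(norm (cpair p))\<^sup>2 = (norm p)\<^sup>2"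
    by (simp add: cpair_def norm_cvec_sq norm_prod_def)
qed auto

lemma cis_scale_cpair:
  "cis \<theta> *s cpair p = cpair (cos \<theta> *\<^sub>R fst p - sin \<theta> *\<^sub>R snd p, sin \<theta> *\<^sub>R fst p + cos \<theta> *\<^sub>R snd p)"
  by (auto simp: cpair_def vec_eq_iff complex_eq_iff)

lemma cpair_surj: "\<exists>p. cpair p = z"
  by (rule exI[of _ "(\<chi> j. Re (z $ j), \<chi> j. Im (z $ j))"]) (simp add: cpair_def vec_eq_iff)

text \<open>Cauchy's formula at the centre of the unit circle; the factor
  \<open>2 * pi * \<i>\<close> cancels against the derivative of the parametrisation.\<close>

lemma holomorphic_circle_mean:
  assumes "g holomorphic_on UNIV"
  shows "(\<integral>s. indicat_real {0..1} s *\<^sub>R g (cis (2 * pi * s)) \<partial>lborel) = g 0"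
proof -
  have cont: "continuous_on UNIV g" using assms by (rule holomorphic_on_imp_continuous_on)
  have "((\<lambda>u. g u / (u - 0)) has_contour_integral (2 * of_real pi * \<i> * g 0)) (circlepath 0 1)"
    by (rule Cauchy_integral_circlepath_simple) (use assms holomorphic_on_subset in auto)
  then have "((\<lambda>s. (g (circlepath 0 1 s) / circlepath 0 1 s) * vector_derivative (circlepath 0 1) (at s within {0..1}))
      has_integral (2 * of_real pi * \<i> * g 0)) {0..1}"
    by (simp add: has_contour_integral_def)
  moreover have "(g (circlepath 0 1 s) / circlepath 0 1 s) * vector_derivative (circlepath 0 1) (at s within {0..1})
     = (2 * of_real pi * \<i>) * g (cis (2 * pi * s))" if "s \<in> {0..1}" for s
    using that by (subst vector_derivative_circlepath01) (simp_all add: circlepath cis_conv_exp mult_ac)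
  ultimately have "((\<lambda>s. (2 * of_real pi * \<i>) * g (cis (2 * pi * s))) has_integral ((2 * of_real pi * \<i>) * g 0)) {0..1}"
    by (rule has_integral_eq[rotated]) auto
  from has_integral_mult_right[OF this, of "1 / (2 * of_real pi * \<i>)"]
  have 1: "((\<lambda>s. g (cis (2 * pi * s))) has_integral g 0) {0..1}"
    by simp
  have "set_integrable lborel {0..1} (\<lambda>s. g (cis (2 * pi * s)))"
    by (intro borel_integrable_atLeastAtMost' continuous_on_compose2[OF cont] continuous_intros) auto
  from set_borel_integral_eq_integral(2)[OF this] integral_unique[OF 1]
  show ?thesis by (simp add: set_lebesgue_integral_def)
qed

text \<open>The Gaussian is invariant under rotation by \<open>cis \<theta>\<close>, so the integral
  equals its average over all such rotations. Exchanging the integrals leaves, for each point, the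
  circle mean of \<open>H\<close> on the complex line through it, which is \<open>H 0\<close>. The
  growth hypothesis makes the integrand absolutely integrable.\<close>

lemma gaussian_mean_value:
  fixes H :: "complex^'n::finite \<Rightarrow> complex"
  assumes cont: "continuous_on UNIV H"
    and hol: "\<And>\<zeta>. (\<lambda>l. H (l *s \<zeta>)) holomorphic_on UNIV"
    and a: "a > 0" and d: "\<delta> > 0"
    and bound: "\<And>\<zeta>. norm (H \<zeta>) * exp (- \<delta> * (norm \<zeta>)\<^sup>2) \<le> M * exp (- a * (norm \<zeta>)\<^sup>2)"
  shows "(\<integral>p. H (cpair p) * of_real (exp (- \<delta> * (norm p)\<^sup>2)) \<partial>lborel)
    = H 0 * of_real (\<integral>p. exp (- \<delta> * (norm (p :: (real^'n) \<times> (real^'n)))\<^sup>2) \<partial>lborel)"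
proof -
  define f where "f s p = H (cis (2 * pi * s) *s cpair p) * of_real (exp (- \<delta> * (norm p)\<^sup>2))"
    for s and p :: "(real^'n) \<times> (real^'n)"
  define R where "R s p = (cos (2 * pi * s) *\<^sub>R fst p - sin (2 * pi * s) *\<^sub>R snd p,
      sin (2 * pi * s) *\<^sub>R fst p + cos (2 * pi * s) *\<^sub>R snd p)" for s and p :: "(real^'n) \<times> (real^'n)"
  have R: "lborel_preserving (R s)" for s
    unfolding R_def by (rule lborel_preserving_rotation) simp
  have cR: "cis (2 * pi * s) *s cpair p = cpair (R s p)" for s p
    by (simp add: cis_scale_cpair R_def)
  have nR: "norm (R s p) = norm p" for s p
  proof -
    have "norm (cis (2 * pi * s) *s cpair p) = norm (cpair p)"
      by (simp add: norm_vec_def norm_mult)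
    then show ?thesis unfolding cR norm_cpair .
  qed
  have fR: "f s p = f 0 (R s p)" for s p
    using cis_scale_cpair[of 0 "R s p"] by (simp add: f_def cR nR)
  have c: "continuous_on UNIV (\<lambda>(s, p). f s p)"
    unfolding f_def case_prod_beta' cis_scale_cpair
    by (intro continuous_intros continuous_on_compose2[OF cont]) auto
  have c0: "continuous_on UNIV (f 0)"
    using continuous_on_compose2[OF c, of UNIV "\<lambda>p. (0, p)"] by (simp add: continuous_on_Pair)
  have m0: "f 0 \<in> borel_measurable borel" "(\<lambda>p. norm (f 0 p)) \<in> borel_measurable borel"
    using c0 by (auto intro!: borel_measurable_continuous_onI continuous_intros)
  have i0: "integrable lborel (f 0)"
  proof (rule Bochner_Integration.integrable_bound)
    show "integrable lborel (\<lambda>p. M * exp (- a * (norm (p :: (real^'n) \<times> (real^'n)))\<^sup>2))"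
      using integrable_exp_neg_norm_sq[OF a] by (rule integrable_mult_right)
    show "AE p in lborel. norm (f 0 p) \<le> norm (M * exp (- a * (norm p)\<^sup>2))"
    proof (intro AE_I2)
      fix p :: "(real^'n) \<times> (real^'n)"
      show "norm (f 0 p) \<le> norm (M * exp (- a * (norm p)\<^sup>2))"
        using order_trans[OF bound[of "cpair p"] abs_ge_self] by (simp add: f_def norm_mult norm_cpair)
    qed
  qed (use m0 in simp)
  have fs: "integrable lborel (f s)" "integral\<^sup>L lborel (f s) = integral\<^sup>L lborel (f 0)"
    \<comment> \<open>Rotation invariance makes integrals and \<open>L\<^sup>1\<close> norms
      independent of \<open>s\<close>; the latter is the uniform bound needed for Fubini.\<close>
    "(\<integral>p. norm (f s p) \<partial>lborel) \<le> (\<integral>p. norm (f 0 p) \<partial>lborel)" for s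
    using lborel_preserving_integral[OF R[of s] m0(1)] lborel_preserving_integral[OF R[of s] m0(2)] i0
    unfolding fR[of s, symmetric] by auto
  have "(\<integral>s. (\<integral>p. indicat_real {0..1} s *\<^sub>R f s p \<partial>lborel) \<partial>lborel)
      = (\<integral>p. (\<integral>s. indicat_real {0..1} s *\<^sub>R f s p \<partial>lborel) \<partial>lborel)"
    by (rule lborel_pair.Fubini_integral[symmetric], rule integrable_unit_interval_product[OF c fs(1,3)])
  also have "(\<integral>s. (\<integral>p. indicat_real {0..1} s *\<^sub>R f s p \<partial>lborel) \<partial>lborel) = integral\<^sup>L lborel (f 0)"
  proof -
    have "(\<integral>p. indicat_real {0..1} s *\<^sub>R f s p \<partial>lborel) = indicat_real {0..1} s *\<^sub>R integral\<^sup>L lborel (f 0)" for s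
      unfolding fs(2)[of s, symmetric] by simp
    then show ?thesis by (simp only:) simp
  qed
  also have "(\<lambda>p. \<integral>s. indicat_real {0..1} s *\<^sub>R f s p \<partial>lborel) = (\<lambda>p. H 0 * of_real (exp (- \<delta> * (norm p)\<^sup>2)))"
    using holomorphic_circle_mean[OF hol]
    by (simp add: f_def scaleR_conv_of_real mult.assoc[symmetric])
  finally show ?thesis
    by (simp add: f_def)
qed

text \<open>Exactly what the circle averaging uses: continuity for measurability, and holomorphy on
  every complex line. It passes directly to products with exponentials of polynomials.\<close>

definition line_holomorphic :: "(complex^'n::finite \<Rightarrow> complex) \<Rightarrow> bool" where
  "line_holomorphic G \<longleftrightarrow> continuous_on UNIV G \<and> (\<forall>w \<zeta>. (\<lambda>l. G (w + l *s \<zeta>)) holomorphic_on UNIV)"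

lemma entire_imp_line_holomorphic:
  assumes "entire F"
  shows "line_holomorphic F"
  unfolding line_holomorphic_def
proof (intro conjI allI)
  show "continuous_on UNIV F"
    using assms unfolding entire_def by (intro continuous_at_imp_continuous_on) (meson has_derivative_continuous)
  fix w \<zeta>
  show "(\<lambda>l. F (w + l *s \<zeta>)) holomorphic_on UNIV"
    unfolding holomorphic_on_def
  proof
    fix l :: complex
    obtain D where D: "(F has_derivative D) (at (w + l *s \<zeta>))" "\<And>c v. D (c *s v) = c * D v"
      using assms unfolding entire_def by blast
    have "bounded_linear (\<lambda>l. l *s \<zeta>)"
      unfolding linear_conv_bounded_linear[symmetric]
      by (intro linearI) (auto simp: vec_eq_iff algebra_simps)
    then have "((\<lambda>l. w + l *s \<zeta>) has_derivative (\<lambda>l. 0 + l *s \<zeta>)) (at l)"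
      by (intro has_derivative_add has_derivative_const bounded_linear_imp_has_derivative)
    \<comment> \<open>Complex homogeneity of \<open>D\<close> turns the real derivative along the
      line into multiplication by the complex number \<open>D \<zeta>\<close>.\<close>
    from has_derivative_compose[OF this D(1)]
    have "((\<lambda>l. F (w + l *s \<zeta>)) has_field_derivative D \<zeta>) (at l)"
      by (simp add: has_field_derivative_def D(2) mult.commute[of _ "D \<zeta>"])
    then show "(\<lambda>l. F (w + l *s \<zeta>)) field_differentiable at l within UNIV"
      by (auto simp: field_differentiable_def)
  qed
qed

text \<open>Translating the variable by \<open>w\<close> turns the reproducing kernel at
  \<open>w\<close> into one centred at the origin, where the Gaussian mean value applies.\<close>

lemma fock_reproducing:
  fixes G :: "complex^'n::finite \<Rightarrow> complex"
  assumes G: "line_holomorphic G" and d: "\<delta> > 0"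
    and bound: "\<And>z. norm (G z) \<le> C * (1 + (norm z)\<^sup>2) ^ m * exp (\<delta> / 2 * (norm z)\<^sup>2)"
  shows "(\<integral>p. G (cpair p) * exp (of_real \<delta> * (\<Sum>j\<in>UNIV. w $ j * cnj (cpair p $ j)) - of_real (\<delta> * (norm p)\<^sup>2)) \<partial>lborel)
    = G w * of_real (\<integral>p. exp (- \<delta> * (norm (p :: (real^'n) \<times> (real^'n)))\<^sup>2) \<partial>lborel)"
proof -
  obtain q where q: "cpair q = w" using cpair_surj by blast
  \<comment> \<open>For \<open>z = w + \<zeta>\<close>, the difference of
    \<open>w \<cdot> cnj z\<close> and the squared norm of \<open>z\<close> is
    \<open>- \<zeta> \<cdot> cnj w\<close> minus the squared norm of \<open>\<zeta>\<close>. The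
    first term is holomorphic in \<open>\<zeta>\<close> and is absorbed in \<open>H\<close>;
    moreover \<open>H 0 = G w\<close>.\<close>
  define H where "H \<zeta> = G (w + \<zeta>) * exp (- of_real \<delta> * (\<Sum>j\<in>UNIV. \<zeta> $ j * cnj (w $ j)))" for \<zeta>
  define \<rho> where "\<rho> = norm w"
  \<comment> \<open>Total coefficient of \<open>r = norm \<zeta>\<close> in the exponent:
    \<open>\<delta> * \<rho>\<close> from the square of \<open>\<rho> + r\<close>,
    \<open>\<delta> * \<rho>\<close> from Cauchy-Schwarz, and \<open>2 * m\<close> from replacing
    the polynomial by an exponential.\<close>
  define b where "b = 2 * \<delta> * \<rho> + 2 * real m"
  have contG: "continuous_on UNIV G" and holG: "\<And>w \<zeta>. (\<lambda>l. G (w + l *s \<zeta>)) holomorphic_on UNIV"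
    using G by (auto simp: line_holomorphic_def)
  have C: "0 \<le> C" using order_trans[OF norm_ge_zero bound[of 0]] by simp
  let ?g = "\<lambda>p. G (cpair p) * exp (of_real \<delta> * (\<Sum>j\<in>UNIV. w $ j * cnj (cpair p $ j)) - of_real (\<delta> * (norm p)\<^sup>2))"
  have sq: "complex_of_real ((norm z)\<^sup>2) = (\<Sum>j\<in>UNIV. z $ j * cnj (z $ j))" for z :: "complex^'n"
    by (simp add: norm_vec_def L2_set_def sum_nonneg complex_norm_square[symmetric] del: of_real_power)
  have shift: "?g (p + q) = H (cpair p) * of_real (exp (- \<delta> * (norm p)\<^sup>2))" for p
  proof -
    have cp: "cpair (p + q) = w + cpair p" using linear_add[OF linear_cpair, of p q] q by simp
    have "of_real \<delta> * (\<Sum>j\<in>UNIV. w $ j * cnj (cpair (p + q) $ j)) - of_real (\<delta> * (norm (p + q))\<^sup>2)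
      = of_real \<delta> * (\<Sum>j\<in>UNIV. w $ j * cnj (cpair (p + q) $ j) - cpair (p + q) $ j * cnj (cpair (p + q) $ j))"
      by (simp add: norm_cpair[symmetric] sq sum_subtractf algebra_simps del: of_real_power)
    also have "\<dots> = of_real \<delta> * (\<Sum>j\<in>UNIV. - (cpair p $ j * cnj (w $ j)) - cpair p $ j * cnj (cpair p $ j))"
      unfolding cp by (intro arg_cong2[where f="(*)"] refl sum.cong) (simp add: algebra_simps)
    also have "\<dots> = - of_real \<delta> * (\<Sum>j\<in>UNIV. cpair p $ j * cnj (w $ j)) + of_real (- \<delta> * (norm p)\<^sup>2)"
      by (simp add: norm_cpair[symmetric] sq sum_subtractf sum_negf algebra_simps del: of_real_power)
    finally show ?thesis unfolding exp_of_real[symmetric] H_def cp by (simp add: exp_add[symmetric] del: exp_of_real)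
  qed
  have contg: "continuous_on UNIV ?g"
    by (intro continuous_intros continuous_on_compose2[OF contG]) auto
  have contH: "continuous_on UNIV H"
    unfolding H_def by (intro continuous_intros continuous_on_compose2[OF contG]) auto
  have holH: "(\<lambda>l. H (l *s \<zeta>)) holomorphic_on UNIV" for \<zeta>
  proof -
    have "(\<lambda>l. exp (- of_real \<delta> * (\<Sum>j\<in>UNIV. l * \<zeta> $ j * cnj (w $ j)))) holomorphic_on UNIV"
      by (intro holomorphic_intros)
    with holG show ?thesis unfolding H_def by (auto intro: holomorphic_on_mult)
  qed
  have bH: "norm (H \<zeta>) * exp (- \<delta> * (norm \<zeta>)\<^sup>2)
      \<le> (C * (1 + \<rho>) ^ (2 * m) * exp (\<delta> / 2 * \<rho>\<^sup>2 + b\<^sup>2 / \<delta>)) * exp (- (\<delta> / 4) * (norm \<zeta>)\<^sup>2)" for \<zeta>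
  proof -
    define r where "r = norm \<zeta>"
    have r: "0 \<le> r" "0 \<le> \<rho>" by (auto simp: r_def \<rho>_def)
    have nz: "norm (w + \<zeta>) \<le> \<rho> + r" by (simp add: r_def \<rho>_def norm_triangle_ineq)
    have "Re (\<Sum>j\<in>UNIV. \<zeta> $ j * cnj (w $ j)) = \<zeta> \<bullet> w"
      by (simp add: inner_vec_def inner_complex_def)
    then have "norm (exp (- of_real \<delta> * (\<Sum>j\<in>UNIV. \<zeta> $ j * cnj (w $ j)))) = exp (- \<delta> * (\<zeta> \<bullet> w))"
      by simp
    also have "\<dots> \<le> exp (\<delta> * (r * \<rho>))"
    proof -
      have "\<delta> * - (\<zeta> \<bullet> w) \<le> \<delta> * (r * \<rho>)"
        using d Cauchy_Schwarz_ineq2[of \<zeta> w] unfolding r_def \<rho>_def by (intro mult_left_mono) auto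
      then show ?thesis by simp
    qed
    finally have 1: "norm (exp (- of_real \<delta> * (\<Sum>j\<in>UNIV. \<zeta> $ j * cnj (w $ j)))) \<le> exp (\<delta> * (r * \<rho>))" .
    have "1 + (norm (w + \<zeta>))\<^sup>2 \<le> 1 + (\<rho> + r)\<^sup>2" using nz by (simp add: power_mono)
    also have "\<dots> \<le> ((1 + \<rho>) * (1 + r))\<^sup>2"
      using r by (simp add: power2_eq_square algebra_simps)
    also have "\<dots> \<le> ((1 + \<rho>) * exp r)\<^sup>2"
      using r exp_ge_add_one_self[of r] by (intro power_mono mult_left_mono) auto
    finally have "(1 + (norm (w + \<zeta>))\<^sup>2) ^ m \<le> (((1 + \<rho>) * exp r)\<^sup>2) ^ m" by (intro power_mono) auto
    also have "\<dots> = (1 + \<rho>) ^ (2 * m) * exp (2 * real m * r)"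
      by (simp add: power_mult_distrib power_mult[symmetric] exp_of_nat_mult[symmetric])
    finally have 2: "(1 + (norm (w + \<zeta>))\<^sup>2) ^ m \<le> (1 + \<rho>) ^ (2 * m) * exp (2 * real m * r)" .
    have 3: "exp (\<delta> / 2 * (norm (w + \<zeta>))\<^sup>2) \<le> exp (\<delta> / 2 * (\<rho> + r)\<^sup>2)"
      using d nz by (simp add: power_mono)
    have "norm (H \<zeta>) \<le> (C * (1 + (norm (w + \<zeta>))\<^sup>2) ^ m * exp (\<delta> / 2 * (norm (w + \<zeta>))\<^sup>2)) * exp (\<delta> * (r * \<rho>))"
      unfolding H_def norm_mult by (intro mult_mono bound 1) (use C in auto)
    also have "\<dots> \<le> (C * ((1 + \<rho>) ^ (2 * m) * exp (2 * real m * r)) * exp (\<delta> / 2 * (\<rho> + r)\<^sup>2)) * exp (\<delta> * (r * \<rho>))"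
      by (intro mult_mono 2 3 order_refl) (use C r in auto)
    finally have "norm (H \<zeta>) * exp (- \<delta> * r\<^sup>2) \<le>
      (C * ((1 + \<rho>) ^ (2 * m) * exp (2 * real m * r)) * exp (\<delta> / 2 * (\<rho> + r)\<^sup>2)) * exp (\<delta> * (r * \<rho>)) * exp (- \<delta> * r\<^sup>2)"
      by (intro mult_right_mono) auto
    also have "\<dots> = C * (1 + \<rho>) ^ (2 * m) * exp (2 * real m * r + \<delta> / 2 * (\<rho> + r)\<^sup>2 + \<delta> * (r * \<rho>) + - \<delta> * r\<^sup>2)"
      unfolding exp_add by (simp only: mult_ac)
    also have "\<dots> \<le> C * (1 + \<rho>) ^ (2 * m) * exp ((\<delta> / 2 * \<rho>\<^sup>2 + b\<^sup>2 / \<delta>) + - (\<delta> / 4) * r\<^sup>2)"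
    proof (intro mult_left_mono exp_mono)
      \<comment> \<open>The net quadratic term is \<open>- (\<delta> / 2) * r\<^sup>2\<close>; half
        of it absorbs \<open>b * r\<close> by completing the square, the other half is the Gaussian
        that remains.\<close>
      have "0 \<le> (\<delta> * r / 2 - b)\<^sup>2 / \<delta>" using d by simp
      also have "\<dots> = \<delta> * r\<^sup>2 / 4 - b * r + b\<^sup>2 / \<delta>"
        using d by (simp add: power2_eq_square field_simps)
      finally show "2 * real m * r + \<delta> / 2 * (\<rho> + r)\<^sup>2 + \<delta> * (r * \<rho>) + - \<delta> * r\<^sup>2
          \<le> (\<delta> / 2 * \<rho>\<^sup>2 + b\<^sup>2 / \<delta>) + - (\<delta> / 4) * r\<^sup>2"
        by (simp add: b_def power2_eq_square algebra_simps)
    qed (use C r in auto)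
    finally show ?thesis unfolding r_def exp_add by (simp only: mult_ac)
  qed
  have "(\<integral>p. ?g p \<partial>lborel) = (\<integral>p. ?g (p + q) \<partial>lborel)"
    using lborel_integral_translation(1)[of ?g q] contg by (simp add: borel_measurable_continuous_onI)
  also have "\<dots> = H 0 * of_real (\<integral>p. exp (- \<delta> * (norm (p :: (real^'n) \<times> (real^'n)))\<^sup>2) \<partial>lborel)"
    unfolding shift by (rule gaussian_mean_value[OF contH holH _ d bH]) (use d in auto)
  finally show ?thesis by (simp add: H_def)
qed

section \<open>Growth of the Mehler kernel\<close>

text \<open>Polynomials jointly in \<open>z\<close> and \<open>u\<close>, so that growth in
  \<open>z\<close> is controlled uniformly. Generating them inductively lets derivatives in
  \<open>u\<close> and growth bounds be found by rule induction.\<close>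

inductive_set poly_fun :: "(complex^'n::finite \<Rightarrow> real^'n \<Rightarrow> complex) set" where
  const: "(\<lambda>z u. c) \<in> poly_fun"
| coord_z: "(\<lambda>z u. z $ j) \<in> poly_fun"
| coord_u: "(\<lambda>z u. of_real (u $ j)) \<in> poly_fun"
| add: "p \<in> poly_fun \<Longrightarrow> q \<in> poly_fun \<Longrightarrow> (\<lambda>z u. p z u + q z u) \<in> poly_fun"
| mult: "p \<in> poly_fun \<Longrightarrow> q \<in> poly_fun \<Longrightarrow> (\<lambda>z u. p z u * q z u) \<in> poly_fun"

lemma coordinate_has_derivative:
  "((\<lambda>h. complex_of_real ((u + h *\<^sub>R axis i 1) $ j)) has_vector_derivative (if i = j then 1 else 0)) (at 0)"
proof -
  have "complex_of_real ((u + h *\<^sub>R axis i 1) $ j) = of_real (u $ j) + h *\<^sub>R (if i = j then 1 else 0)" for h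
    by (auto simp: axis_def of_real_def algebra_simps)
  then show ?thesis by (auto simp: has_vector_derivative_def intro!: derivative_eq_intros)
qed

lemma poly_fun_has_derivative:
  assumes "p \<in> poly_fun"
  shows "\<exists>q\<in>poly_fun. \<forall>z u. ((\<lambda>h. p z (u + h *\<^sub>R axis i 1)) has_vector_derivative q z u) (at 0)"
  using assms
proof induction
  case (const c)
  show ?case by (rule bexI[OF _ poly_fun.const[of 0]]) auto
next
  case (coord_z j)
  show ?case by (rule bexI[OF _ poly_fun.const[of 0]]) auto
next
  case (coord_u j)
  show ?case by (intro bexI[OF _ poly_fun.const[of "if i = j then 1 else 0"]] allI coordinate_has_derivative)
next
  case (add p q)
  then obtain p' q' where *: "p' \<in> poly_fun" "q' \<in> poly_fun"
    "\<And>z u. ((\<lambda>h. p z (u + h *\<^sub>R axis i 1)) has_vector_derivative p' z u) (at 0)"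
    "\<And>z u. ((\<lambda>h. q z (u + h *\<^sub>R axis i 1)) has_vector_derivative q' z u) (at 0)" by blast
  show ?case
    by (rule bexI[OF _ poly_fun.add[OF *(1,2)]]) (auto intro!: has_vector_derivative_add *)
next
  case (mult p q)
  then obtain p' q' where *: "p' \<in> poly_fun" "q' \<in> poly_fun"
    "\<And>z u. ((\<lambda>h. p z (u + h *\<^sub>R axis i 1)) has_vector_derivative p' z u) (at 0)"
    "\<And>z u. ((\<lambda>h. q z (u + h *\<^sub>R axis i 1)) has_vector_derivative q' z u) (at 0)" by blast
  show ?case
    by (rule bexI[OF _ poly_fun.add[OF poly_fun.mult[OF mult.hyps(1) *(2)] poly_fun.mult[OF *(1) mult.hyps(2)]]])
      (use has_vector_derivative_mult[OF *(3,4)] in auto)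
qed

lemma poly_fun_differentiable:
  assumes "p \<in> poly_fun"
  shows "p z differentiable (at u)"
  using assms
proof induction
  case (coord_u j)
  have "bounded_linear (\<lambda>u. complex_of_real (u $ j))"
    by (intro bounded_linear_compose[OF bounded_linear_of_real bounded_linear_vec_nth])
  then show ?case using bounded_linear_imp_differentiable by blast
qed (auto intro: derivative_intros)

lemma poly_fun_bound:
  assumes "p \<in> poly_fun"
  shows "\<exists>C N. 0 \<le> C \<and> (\<forall>z u. norm (p z u) \<le> C * (1 + norm z + norm u) ^ N)"
  using assms
proof induction
  case (const c)
  show ?case by (intro exI[of _ "norm c"] exI[of _ 0]) auto
next
  case (coord_z j)
  have "norm (z $ j) \<le> 1 * (1 + norm z + norm u) ^ 1" for z and u :: "real^'a"
    using Finite_Cartesian_Product.norm_nth_le[of z j] by (smt (verit) norm_ge_zero power_one_right mult_1)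
  then show ?case by (intro exI[of _ 1]) auto
next
  case (coord_u j)
  have "norm (complex_of_real (u $ j)) \<le> 1 * (1 + norm z + norm u) ^ 1" for z :: "complex^'a" and u :: "real^'a"
    using Finite_Cartesian_Product.norm_nth_le[of u j] by (smt (verit) norm_ge_zero norm_of_real power_one_right mult_1 real_norm_def)
  then show ?case by (intro exI[of _ 1]) auto
next
  case (add p q)
  then obtain A M B N where A: "0 \<le> A" "\<And>z u. norm (p z u) \<le> A * (1 + norm z + norm u) ^ M"
    and B: "0 \<le> B" "\<And>z u. norm (q z u) \<le> B * (1 + norm z + norm u) ^ N" by blast
  have "norm (p z u + q z u) \<le> (A + B) * (1 + norm z + norm u) ^ max M N" for z u
  proof -
    let ?w = "1 + norm z + norm u"
    have "norm (p z u + q z u) \<le> A * ?w ^ M + B * ?w ^ N"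
      using A(2)[of z u] B(2)[of z u] by (intro norm_triangle_le) linarith
    also have "\<dots> \<le> A * ?w ^ max M N + B * ?w ^ max M N"
      by (intro add_mono mult_left_mono power_increasing A(1) B(1)) auto
    finally show ?thesis by (simp add: algebra_simps)
  qed
  then show ?case using A(1) B(1) by (intro exI[of _ "A + B"] exI[of _ "max M N"]) auto
next
  case (mult p q)
  then obtain A M B N where A: "0 \<le> A" "\<And>z u. norm (p z u) \<le> A * (1 + norm z + norm u) ^ M"
    and B: "0 \<le> B" "\<And>z u. norm (q z u) \<le> B * (1 + norm z + norm u) ^ N" by blast
  have "norm (p z u * q z u) \<le> (A * B) * (1 + norm z + norm u) ^ (M + N)" for z u
    using mult_mono[OF A(2)[of z u] B(2)[of z u]] A(1) by (simp add: norm_mult power_add mult_ac)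
  then show ?case using A(1) B(1) by (intro exI[of _ "A * B"] exI[of _ "M + N"]) auto
qed

lemma has_vector_derivative_exp_complex:
  assumes "(g has_vector_derivative g') (at (t::real))"
  shows "((\<lambda>t. exp (g t :: complex)) has_vector_derivative (g' * exp (g t))) (at t)"
  using field_vector_diff_chain_at[OF assms DERIV_exp] by (simp add: o_def)

text \<open>After \<open>1 + r \<le> exp r\<close>, the right-hand exponent is the maximum of
  \<open>L * r - a * r\<^sup>2\<close>.\<close>

lemma power_exp_bound:
  fixes a r :: real
  assumes "a > 0" "r \<ge> 0"
  shows "(1 + r) ^ L * exp (- a * r\<^sup>2) \<le> exp ((real L)\<^sup>2 / (4 * a))"
proof -
  have "(1 + r) ^ L * exp (- a * r\<^sup>2) \<le> exp r ^ L * exp (- a * r\<^sup>2)"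
    using assms exp_ge_add_one_self[of r] by (intro mult_right_mono power_mono) auto
  also have "\<dots> = exp (real L * r - a * r\<^sup>2)"
    by (simp add: exp_of_nat_mult[symmetric] exp_add[symmetric])
  also have "\<dots> \<le> exp ((real L)\<^sup>2 / (4 * a))"
  proof (rule exp_mono)
    have "0 \<le> (real L - 2 * a * r)\<^sup>2 / (4 * a)" using assms by simp
    also have "\<dots> = (real L)\<^sup>2 / (4 * a) - (real L * r - a * r\<^sup>2)"
      using assms by (simp add: power2_eq_square field_simps)
    finally show "real L * r - a * r\<^sup>2 \<le> (real L)\<^sup>2 / (4 * a)" by simp
  qed
  finally show ?thesis .
qed

section \<open>The Mehler kernel: modulus, derivatives and Schwartz norms\<close>

text \<open>\<open>ty\<close> pins down the dimension, on which constants such as \<open>c0\<close>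
  depend although their types do not mention it.\<close>

locale mehler =
  fixes t :: real and ty :: "'n::finite itself"
  assumes t_pos: "0 < t"
begin

abbreviation \<sigma> :: real where "\<sigma> \<equiv> sinh (2 * t)"
abbreviation \<gamma> :: real where "\<gamma> \<equiv> cosh (2 * t)"
abbreviation \<beta> :: real where "\<beta> \<equiv> coth (2 * t)"
abbreviation \<alpha> :: real where "\<alpha> \<equiv> tanh (2 * t)"

definition c0 :: real where
  "c0 = (2 * pi) powr (- (real CARD('n) / 2)) * \<sigma> powr (- (real CARD('n) / 2))"

abbreviation K :: "complex^'n \<Rightarrow> real^'n \<Rightarrow> complex" where "K \<equiv> mehler_kernel t"

text \<open>Square root of the exponential factor in the growth condition.\<close>

definition E :: "real^'n \<Rightarrow> real^'n \<Rightarrow> real" where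
  "E x y = exp ((- \<alpha> * (norm x)\<^sup>2 + \<beta> * (norm y)\<^sup>2) / 2)"

lemma E_pos: "0 < E x y" by (simp add: E_def)

lemma \<sigma>_pos: "0 < \<sigma>" using t_pos by simp

lemma \<gamma>_pos: "0 < \<gamma>" by simp

lemma \<gamma>_ge_1: "1 \<le> \<gamma>" by (rule cosh_real_ge_1)

lemma \<beta>_pos: "0 < \<beta>" using \<sigma>_pos by (simp add: coth_def)

lemma \<alpha>_\<beta>: "\<beta> - \<alpha> = 1 / (\<sigma> * \<gamma>)"
proof -
  have "\<gamma> * \<gamma> - \<sigma> * \<sigma> = 1" using cosh_square_eq[of "2 * t"] by (simp add: power2_eq_square)
  then show ?thesis using \<sigma>_pos \<gamma>_pos by (simp add: coth_def tanh_def field_simps)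
qed

lemma c0_pos: "0 < c0" using \<sigma>_pos by (simp add: c0_def)

lemma kernel_eq:
  "K z u = of_real c0 * exp (- (1 / 2) * of_real \<beta> * ((\<Sum>j\<in>UNIV. (z $ j)\<^sup>2) + (\<Sum>j\<in>UNIV. (of_real (u $ j))\<^sup>2))
          + 1 / of_real \<sigma> * (\<Sum>j\<in>UNIV. z $ j * of_real (u $ j)))"
  by (simp add: mehler_kernel_def c0_def)

text \<open>Completing the square in \<open>u\<close>: the centre \<open>x / \<gamma>\<close>
  matches the linear term because \<open>\<beta> / \<gamma> = 1 / \<sigma>\<close>, and
  \<open>\<beta> / \<gamma>\<^sup>2 = \<beta> - \<alpha>\<close> changes the coefficient of the
  squared norm of \<open>x\<close> from \<open>- \<beta> / 2\<close> to
  \<open>- \<alpha> / 2\<close>.\<close>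

lemma norm_kernel:
  "norm (K (cvec x y) u) = c0 * E x y * exp (- (\<beta> / 2) * (norm (u - (1 / \<gamma>) *\<^sub>R x))\<^sup>2)"
proof -
  have "\<gamma> / \<sigma> = \<beta>" by (simp add: coth_def)
  have 1: "Re (\<Sum>j\<in>UNIV. (cvec x y $ j)\<^sup>2) = (norm x)\<^sup>2 - (norm y)\<^sup>2"
    by (simp only: power2_norm_eq_inner inner_vec_def) (simp add: power2_eq_square sum_subtractf)
  have 2: "Re (\<Sum>j\<in>UNIV. (complex_of_real (u $ j))\<^sup>2) = (norm u)\<^sup>2"
    by (simp only: power2_norm_eq_inner inner_vec_def) (simp add: power2_eq_square)
  have 3: "Re (\<Sum>j\<in>UNIV. cvec x y $ j * of_real (u $ j)) = u \<bullet> x"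
    by (simp add: inner_vec_def mult.commute)
  have R: "Re (- (1 / 2) * of_real \<beta> * p + 1 / of_real \<sigma> * q) = - (1 / 2) * \<beta> * Re p + Re q / \<sigma>" for p q
  proof -
    have "- (1 / 2) * complex_of_real \<beta> * p + 1 / of_real \<sigma> * q = of_real (- (1 / 2) * \<beta>) * p + of_real (1 / \<sigma>) * q"
      by simp
    also have "Re \<dots> = - (1 / 2) * \<beta> * Re p + Re q / \<sigma>" by simp
    finally show ?thesis .
  qed
  have "- (1 / 2) * \<beta> * ((norm x)\<^sup>2 - (norm y)\<^sup>2 + (norm u)\<^sup>2) + (u \<bullet> x) / \<sigma>
      = (- \<alpha> * (norm x)\<^sup>2 + \<beta> * (norm y)\<^sup>2) / 2 + - (\<beta> / 2) * (norm (u - (1 / \<gamma>) *\<^sub>R x))\<^sup>2"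
  proof -
    have n: "(norm (u - a *\<^sub>R x))\<^sup>2 = (norm u)\<^sup>2 - 2 * a * (u \<bullet> x) + a\<^sup>2 * (norm x)\<^sup>2" for a
      unfolding power2_norm_eq_inner
      by (simp add: inner_diff_left inner_diff_right inner_commute power2_eq_square algebra_simps)
    have b1: "\<beta> / \<gamma> = 1 / \<sigma>" using \<gamma>_pos by (simp add: coth_def)
    have b2: "\<beta> / \<gamma>\<^sup>2 = \<beta> - \<alpha>" unfolding \<alpha>_\<beta> using \<gamma>_pos by (simp add: coth_def power2_eq_square)
    have "(\<beta> / 2) * (norm (u - (1 / \<gamma>) *\<^sub>R x))\<^sup>2
        = (\<beta> / 2) * (norm u)\<^sup>2 - (\<beta> / \<gamma>) * (u \<bullet> x) + (\<beta> / \<gamma>\<^sup>2) * (norm x)\<^sup>2 / 2"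
      unfolding n[of "1 / \<gamma>"] by (simp add: power_divide algebra_simps)
    then have "- (\<beta> / 2) * (norm (u - (1 / \<gamma>) *\<^sub>R x))\<^sup>2
        = - ((\<beta> / 2) * (norm u)\<^sup>2 - (1 / \<sigma>) * (u \<bullet> x) + (\<beta> - \<alpha>) * (norm x)\<^sup>2 / 2)"
      unfolding b1 b2 by (simp only: mult_minus_left)
    then show ?thesis by (simp only:) (simp add: algebra_simps diff_divide_distrib add_divide_distrib)
  qed
  then have "cmod (of_real c0) * exp (- (1 / 2) * \<beta> * ((norm x)\<^sup>2 - (norm y)\<^sup>2 + (norm u)\<^sup>2) + (u \<bullet> x) / \<sigma>)
      = c0 * E x y * exp (- (\<beta> / 2) * (norm (u - (1 / \<gamma>) *\<^sub>R x))\<^sup>2)"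
    using c0_pos by (simp only: E_def exp_add) simp
  then show ?thesis
    unfolding kernel_eq norm_mult norm_exp_eq_Re R
    unfolding plus_complex.sel 1 2 3 .
qed

lemma kernel_has_derivative:
  "((\<lambda>h. K z (u + h *\<^sub>R axis i 1)) has_vector_derivative (z $ i / of_real \<sigma> - of_real \<beta> * of_real (u $ i)) * K z u) (at 0)"
proof -
  let ?g = "\<lambda>u. - (1 / 2) * of_real \<beta> * ((\<Sum>j\<in>UNIV. (z $ j)\<^sup>2) + (\<Sum>j\<in>UNIV. (of_real (u $ j))\<^sup>2))
          + 1 / of_real \<sigma> * (\<Sum>j\<in>UNIV. z $ j * of_real (u $ j)) :: complex"
  note c = coordinate_has_derivative[of u i]
  have c2: "((\<lambda>h. (complex_of_real ((u + h *\<^sub>R axis i 1) $ j))\<^sup>2) has_vector_derivative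
      (if i = j then 2 * of_real (u $ j) else 0)) (at 0)" for j
    unfolding power2_eq_square
    by (rule has_vector_derivative_eq_rhs[OF has_vector_derivative_mult[OF c[of j] c[of j]]]) simp
  have "((\<lambda>h. ?g (u + h *\<^sub>R axis i 1)) has_vector_derivative
      (- (1 / 2) * of_real \<beta> * (0 + (\<Sum>j\<in>UNIV. if i = j then 2 * of_real (u $ j) else 0))
       + 1 / of_real \<sigma> * (\<Sum>j\<in>UNIV. z $ j * (if i = j then 1 else 0)))) (at 0)"
    by (intro has_vector_derivative_add has_vector_derivative_mult_right has_vector_derivative_sum
        has_vector_derivative_const c c2)
  also have "(- (1 / 2) * of_real \<beta> * (0 + (\<Sum>j\<in>UNIV. if i = j then 2 * of_real (u $ j) else 0))
       + 1 / of_real \<sigma> * (\<Sum>j\<in>UNIV. z $ j * (if i = j then 1 else 0)))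
       = (z $ i / of_real \<sigma> - of_real \<beta> * of_real (u $ i))"
    by (simp add: if_distrib cong: if_cong)
  finally have "((\<lambda>h. of_real c0 * exp (?g (u + h *\<^sub>R axis i 1))) has_vector_derivative
     of_real c0 * ((z $ i / of_real \<sigma> - of_real \<beta> * of_real (u $ i)) * exp (?g (u + 0 *\<^sub>R axis i 1)))) (at 0)"
    by (intro has_vector_derivative_mult_right has_vector_derivative_exp_complex)
  then show ?thesis unfolding kernel_eq by (simp add: mult_ac)
qed

lemma kernel_differentiable: "K z differentiable (at u)"
proof -
  have c: "(\<lambda>u. complex_of_real (u $ j)) differentiable (at u)" for j and u :: "real^'n"
    by (intro bounded_linear_imp_differentiable bounded_linear_compose[OF bounded_linear_of_real bounded_linear_vec_nth])
  have g: "(\<lambda>u. - (1 / 2) * of_real \<beta> * ((\<Sum>j\<in>UNIV. (z $ j)\<^sup>2) + (\<Sum>j\<in>UNIV. (of_real (u $ j))\<^sup>2))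
          + 1 / of_real \<sigma> * (\<Sum>j\<in>UNIV. z $ j * of_real (u $ j)) :: complex) differentiable (at u)"
    unfolding power2_eq_square
    by (intro differentiable_add differentiable_mult differentiable_const differentiable_sum ballI c) auto
  have e: "exp differentiable (at w)" for w :: complex
    using DERIV_exp[of w] by (auto simp: has_field_derivative_def differentiable_def)
  show ?thesis
    unfolding kernel_eq[abs_def]
    by (intro differentiable_mult differentiable_const differentiable_chain_at[OF g e, unfolded o_def])
qed

text \<open>The logarithmic derivative of the kernel is affine in \<open>z\<close> and
  \<open>u\<close>, so differentiation keeps the form polynomial times kernel. One polynomial serves
  all \<open>z\<close>, which keeps later constants uniform.\<close>

lemma iter_partial_kernel:
  "\<exists>q\<in>poly_fun. \<forall>z. iter_partial is (K z) = (\<lambda>u. q z u * K z u)"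
proof (induction "is")
  case Nil
  show ?case by (rule bexI[OF _ poly_fun.const[of 1]]) auto
next
  case (Cons i "is")
  then obtain q where q: "q \<in> poly_fun" "\<And>z. iter_partial is (K z) = (\<lambda>u. q z u * K z u)" by blast
  obtain q' where q': "q' \<in> poly_fun"
    "\<And>z u. ((\<lambda>h. q z (u + h *\<^sub>R axis i 1)) has_vector_derivative q' z u) (at 0)"
    using poly_fun_has_derivative[OF q(1)] by blast
  define l :: "complex^'n \<Rightarrow> real^'n \<Rightarrow> complex" where
    "l = (\<lambda>z u. of_real (1 / \<sigma>) * z $ i + of_real (- \<beta>) * of_real (u $ i))"
  have l: "l \<in> poly_fun" unfolding l_def by (intro poly_fun.intros)
  have "iter_partial (i # is) (K z) u = (q z u * l z u + q' z u) * K z u" for z u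
    unfolding iter_partial.simps q(2)
    by (rule partial_deriv_eqI, rule has_vector_derivative_eq_rhs,
        rule has_vector_derivative_mult[OF q'(2) kernel_has_derivative])
      (simp add: l_def algebra_simps)
  then show ?case
    by (intro bexI[OF _ poly_fun.add[OF poly_fun.mult[OF q(1) l] q'(1)]]) auto
qed

lemma smooth_kernel: "smooth (K z)"
  unfolding smooth_def
proof (intro allI)
  fix "is" u
  obtain q where q: "q \<in> poly_fun" "\<And>z. iter_partial is (K z) = (\<lambda>u. q z u * K z u)"
    using iter_partial_kernel by blast
  show "iter_partial is (K z) differentiable (at u)"
    unfolding q(2) by (intro differentiable_mult poly_fun_differentiable q(1) kernel_differentiable)
qed

text \<open>In the variable \<open>v = u - x / \<gamma>\<close> the kernel is a centred Gaussian,
  which absorbs every power of \<open>1 + norm v\<close>; since \<open>\<gamma> \<ge> 1\<close>, the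
  remaining weight is a power of \<open>1 + norm z\<close>.\<close>

lemma kernel_weighted_bound:
  "\<exists>C\<ge>0. \<forall>x y u. (1 + norm (cvec x y) + norm u) ^ L * norm (K (cvec x y) u) \<le> C * (1 + norm (cvec x y)) ^ L * E x y"
proof (intro exI conjI allI)
  define C where "C = c0 * 2 ^ L * exp ((real L)\<^sup>2 / (4 * (\<beta> / 2)))"
  show "0 \<le> C" using c0_pos by (simp add: C_def)
  fix x y u :: "real^'n"
  define v where "v = u - (1 / \<gamma>) *\<^sub>R x"
  define w where "w = norm (cvec x y)"
  have "norm x \<le> w"
    unfolding w_def by (rule power2_le_imp_le) (simp_all add: norm_cvec_sq)
  moreover have "norm ((1 / \<gamma>) *\<^sub>R x) \<le> norm x"
    using \<gamma>_ge_1 by (simp add: divide_le_eq mult_le_cancel_left1)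
  ultimately have "norm u \<le> norm v + w"
    using norm_triangle_ineq[of v "(1 / \<gamma>) *\<^sub>R x"] by (simp add: v_def)
  moreover have w: "0 \<le> w" by (simp add: w_def)
  moreover have "0 \<le> w * norm v" using w by simp
  moreover have "2 * (1 + w) * (1 + norm v) = 2 + 2 * w + 2 * norm v + 2 * (w * norm v)"
    by (simp add: algebra_simps)
  ultimately have "1 + w + norm u \<le> 2 * (1 + w) * (1 + norm v)"
    using norm_ge_zero[of v] by linarith
  then have "(1 + w + norm u) ^ L \<le> (2 * (1 + w) * (1 + norm v)) ^ L"
    using w by (intro power_mono) auto
  then have "(1 + w + norm u) ^ L * norm (K (cvec x y) u) \<le>
      (2 * (1 + w) * (1 + norm v)) ^ L * (c0 * E x y * exp (- (\<beta> / 2) * (norm v)\<^sup>2))"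
    unfolding norm_kernel v_def[symmetric] using c0_pos E_pos[of x y] by (intro mult_right_mono) auto
  also have "\<dots> = (c0 * 2 ^ L * (1 + w) ^ L * E x y) * ((1 + norm v) ^ L * exp (- (\<beta> / 2) * (norm v)\<^sup>2))"
    by (simp only: power_mult_distrib mult_ac)
  also have "\<dots> \<le> (c0 * 2 ^ L * (1 + w) ^ L * E x y) * exp ((real L)\<^sup>2 / (4 * (\<beta> / 2)))"
    using c0_pos E_pos[of x y] w \<beta>_pos by (intro mult_left_mono power_exp_bound) auto
  finally show "(1 + norm (cvec x y) + norm u) ^ L * norm (K (cvec x y) u) \<le> C * (1 + norm (cvec x y)) ^ L * E x y"
    by (simp add: C_def w_def mult_ac)
qed

lemma kernel_seminorm_weighted_bound:
  "\<exists>C M. 0 \<le> C \<and> (\<forall>x y u. (1 + norm u) ^ k * norm (iter_partial is (K (cvec x y)) u)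
      \<le> C * (1 + norm (cvec x y)) ^ M * E x y)"
proof -
  obtain q where q: "q \<in> poly_fun" "\<And>z. iter_partial is (K z) = (\<lambda>u. q z u * K z u)"
    using iter_partial_kernel by blast
  obtain A N where A: "0 \<le> A" "\<And>z u. norm (q z u) \<le> A * (1 + norm z + norm u) ^ N"
    using poly_fun_bound[OF q(1)] by blast
  obtain B where B: "0 \<le> B" "\<And>x y u. (1 + norm (cvec x y) + norm u) ^ (k + N) * norm (K (cvec x y) u)
      \<le> B * (1 + norm (cvec x y)) ^ (k + N) * E x y"
    using kernel_weighted_bound by blast
  have "(1 + norm u) ^ k * norm (iter_partial is (K (cvec x y)) u)
      \<le> (A * B) * (1 + norm (cvec x y)) ^ (k + N) * E x y" for x y u
  proof -
    let ?w = "1 + norm (cvec x y) + norm u"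
    have "(1 + norm u) ^ k * norm (iter_partial is (K (cvec x y)) u) =
       ((1 + norm u) ^ k * norm (q (cvec x y) u)) * norm (K (cvec x y) u)"
      by (simp add: q(2) norm_mult mult_ac)
    also have "\<dots> \<le> (?w ^ k * (A * ?w ^ N)) * norm (K (cvec x y) u)"
      by (intro mult_right_mono mult_mono A power_mono) auto
    also have "\<dots> = A * (?w ^ (k + N) * norm (K (cvec x y) u))" by (simp add: power_add mult_ac)
    also have "\<dots> \<le> A * (B * (1 + norm (cvec x y)) ^ (k + N) * E x y)"
      by (intro mult_left_mono A B)
    finally show ?thesis by (simp add: mult_ac)
  qed
  then show ?thesis using A B by (intro exI[of _ "A * B"] exI[of _ "k + N"]) auto
qed

lemma kernel_in_schwartz: "K z \<in> schwartz"
proof -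
  obtain p where p: "cpair p = z" using cpair_surj by blast
  show ?thesis
    using kernel_seminorm_weighted_bound smooth_kernel unfolding p[symmetric] cpair_def
    by (intro schwartzI) blast+
qed

lemma kernel_seminorm_bound:
  "\<exists>C M. 0 \<le> C \<and> (\<forall>x y. schwartz_seminorm k is (K (cvec x y)) \<le> C * (1 + norm (cvec x y)) ^ M * E x y)"
  using kernel_seminorm_weighted_bound[of k "is"] by (meson schwartz_seminorm_least)

lemma kernel_norm_bound:
  "\<exists>C M. 0 \<le> C \<and> (\<forall>x y. schwartz_norm N (K (cvec x y)) \<le> C * (1 + norm (cvec x y)) ^ M * E x y)"
proof -
  obtain C M where C: "\<And>is. 0 \<le> C is" and M: "\<And>is x y. schwartz_seminorm N is (K (cvec x y))
      \<le> C is * (1 + norm (cvec x y)) ^ M is * E x y"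
    using kernel_seminorm_bound[of N] by metis
  define L :: "'n list set" where "L = short_lists N"
  have L: "finite L" by (simp add: L_def)
  \<comment> \<open>A common exponent: the sum dominates each \<open>M is\<close>, and the base is
    at least \<open>1\<close>.\<close>
  define M' where "M' = sum M L"
  have "schwartz_norm N (K (cvec x y)) \<le> (\<Sum>is\<in>L. C is) * (1 + norm (cvec x y)) ^ M' * E x y" for x y
  proof -
    have "schwartz_norm N (K (cvec x y)) \<le> (\<Sum>is\<in>L. C is * (1 + norm (cvec x y)) ^ M' * E x y)"
      unfolding schwartz_norm_def L_def[symmetric]
    proof (rule sum_mono)
      fix "is" assume "is \<in> L"
      then have "M is \<le> M'" unfolding M'_def using L by (intro member_le_sum) auto
      then have "C is * (1 + norm (cvec x y)) ^ M is * E x y \<le> C is * (1 + norm (cvec x y)) ^ M' * E x y"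
        using C E_pos[of x y] by (intro mult_right_mono mult_left_mono power_increasing) auto
      then show "schwartz_seminorm N is (K (cvec x y)) \<le> C is * (1 + norm (cvec x y)) ^ M' * E x y"
        using M order_trans by blast
    qed
    then show ?thesis by (simp add: sum_distrib_right)
  qed
  then show ?thesis using C by (intro exI[of _ "\<Sum>is\<in>L. C is"] exI[of _ M']) (auto intro: sum_nonneg)
qed

text \<open>The continuity estimate of \<open>f\<close> applied to the kernel, whose Schwartz norms
  grow polynomially relative to \<open>E\<close>.\<close>

lemma tempered_imp_growth:
  assumes "tempered_distribution f"
  shows "\<exists>(m::nat) (C::real). \<forall>x y. (norm (f (K (cvec x y))))\<^sup>2 \<le>
              C * (1 + (norm (cvec x y))\<^sup>2) ^ (2 * m) * (E x y)\<^sup>2"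
proof -
  obtain N A where A: "0 \<le> A" "\<And>\<phi>. \<phi> \<in> schwartz \<Longrightarrow> norm (f \<phi>) \<le> A * schwartz_norm N \<phi>"
    using tempered_distribution_bound[OF assms] by blast
  obtain B M where B: "0 \<le> B" "\<And>x y. schwartz_norm N (K (cvec x y)) \<le> B * (1 + norm (cvec x y)) ^ M * E x y"
    using kernel_norm_bound by blast
  have "(norm (f (K (cvec x y))))\<^sup>2 \<le> (A * B * 2 ^ M)\<^sup>2 * (1 + (norm (cvec x y))\<^sup>2) ^ (2 * M) * (E x y)\<^sup>2" for x y
  proof -
    define r where "r = norm (cvec x y)"
    have "0 \<le> (r - 1)\<^sup>2 + r\<^sup>2" by simp
    moreover have "0 \<le> r" by (simp add: r_def)
    ultimately have "1 + r \<le> 2 * (1 + r\<^sup>2)" by (simp add: power2_eq_square algebra_simps)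
    then have r: "(1 + r) ^ M \<le> (2 * (1 + r\<^sup>2)) ^ M" by (intro power_mono) (auto simp: r_def)
    have "norm (f (K (cvec x y))) \<le> A * schwartz_norm N (K (cvec x y))" by (intro A kernel_in_schwartz)
    also have "\<dots> \<le> A * (B * (1 + r) ^ M * E x y)" unfolding r_def by (intro mult_left_mono A B)
    also have "\<dots> \<le> A * (B * (2 * (1 + r\<^sup>2)) ^ M * E x y)"
      using r A(1) B(1) E_pos[of x y] by (intro mult_left_mono mult_right_mono) auto
    finally have "(norm (f (K (cvec x y))))\<^sup>2 \<le> (A * (B * (2 * (1 + r\<^sup>2)) ^ M * E x y))\<^sup>2"
      by (intro power_mono) auto
    also have "\<dots> = (A * B * 2 ^ M)\<^sup>2 * (1 + r\<^sup>2) ^ (2 * M) * (E x y)\<^sup>2"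
      unfolding power_mult_distrib power_mult[symmetric] by (simp add: mult_ac)
    finally show ?thesis by (simp add: r_def)
  qed
  then show ?thesis by blast
qed

end

section \<open>Decay of the transform of a Schwartz function\<close>

context mehler
begin

text \<open>The \<open>L\<^sup>1\<close> norm of the kernel in \<open>u\<close> is this constant
  times \<open>E x y\<close>, as the Gaussian factor is merely translated.\<close>

definition kernel_mass :: real where
  "kernel_mass = c0 * (\<integral>u. exp (- (\<beta> / 2) * (norm (u :: real^'n))\<^sup>2) \<partial>lborel)"

lemma kernel_mass_nonneg: "0 \<le> kernel_mass"
  using c0_pos by (simp add: kernel_mass_def)

lemma continuous_kernel: "continuous_on UNIV (\<lambda>u. K z u)"
  using kernel_differentiable differentiable_imp_continuous_within continuous_at_imp_continuous_on by blast

lemma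
  shows integrable_norm_kernel: "integrable lborel (\<lambda>u. norm (K (cvec x y) u))"
    and integral_norm_kernel: "(\<integral>u. norm (K (cvec x y) u) \<partial>lborel) = kernel_mass * E x y"
proof -
  let ?h = "\<lambda>u::real^'n. exp (- (\<beta> / 2) * (norm u)\<^sup>2)"
  have m: "?h \<in> borel_measurable borel" by measurable
  have i: "integrable lborel ?h" using integrable_exp_neg_norm_sq[of "\<beta> / 2"] \<beta>_pos by simp
  have "integrable lborel (\<lambda>u. ?h (u + - ((1 / \<gamma>) *\<^sub>R x)))" "(\<integral>u. ?h (u + - ((1 / \<gamma>) *\<^sub>R x)) \<partial>lborel) = integral\<^sup>L lborel ?h"
    using lborel_integral_translation[OF m] i by blast+
  then show "integrable lborel (\<lambda>u. norm (K (cvec x y) u))" "(\<integral>u. norm (K (cvec x y) u) \<partial>lborel) = kernel_mass * E x y"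
    unfolding norm_kernel by (auto simp: kernel_mass_def)
qed

lemma
  fixes g :: "real^'n \<Rightarrow> complex"
  assumes g: "g \<in> borel_measurable borel" and bound: "\<And>u. norm (g u) \<le> M"
  shows integrable_mult_kernel: "integrable lborel (\<lambda>u. g u * K (cvec x y) u)"
    and norm_integral_mult_kernel: "norm (\<integral>u. g u * K (cvec x y) u \<partial>lborel) \<le> M * kernel_mass * E x y"
proof -
  have K: "(\<lambda>u. K (cvec x y) u) \<in> borel_measurable borel"
    by (rule borel_measurable_continuous_onI[OF continuous_kernel])
  have M: "0 \<le> M" using order_trans[OF norm_ge_zero bound[of 0]] .
  have i: "integrable lborel (\<lambda>u. M * norm (K (cvec x y) u))"
    using integrable_norm_kernel by (rule integrable_mult_right)
  have b: "norm (g u * K (cvec x y) u) \<le> M * norm (K (cvec x y) u)" for u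
    by (simp add: norm_mult mult_right_mono bound)
  show int: "integrable lborel (\<lambda>u. g u * K (cvec x y) u)"
    by (rule Bochner_Integration.integrable_bound[OF i]) (use g K b M in \<open>auto simp: abs_mult\<close>)
  have "norm (\<integral>u. g u * K (cvec x y) u \<partial>lborel) \<le> (\<integral>u. norm (g u * K (cvec x y) u) \<partial>lborel)"
    by (rule integral_norm_bound)
  also have "\<dots> \<le> (\<integral>u. M * norm (K (cvec x y) u) \<partial>lborel)"
    by (rule integral_mono[OF integrable_norm[OF int] i b])
  also have "\<dots> = M * kernel_mass * E x y" by (simp add: integral_norm_kernel)
  finally show "norm (\<integral>u. g u * K (cvec x y) u \<partial>lborel) \<le> M * kernel_mass * E x y" .
qed

lemma schwartz_differentiable: "\<phi> \<in> schwartz \<Longrightarrow> iter_partial is \<phi> differentiable (at u)"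
  by (intro smooth_differentiable schwartz_imp_smooth)

lemma poly_schwartz_continuous:
  assumes "p \<in> poly_fun" "\<phi> \<in> schwartz"
  shows "continuous_on UNIV (\<lambda>u. p z u * iter_partial is \<phi> u)"
  by (intro continuous_at_imp_continuous_on ballI differentiable_imp_continuous_within differentiable_mult
      poly_fun_differentiable schwartz_differentiable assms)

text \<open>Polynomial growth in \<open>u\<close> is paid for by the weight in a Schwartz seminorm.
  Uniformity in \<open>\<phi>\<close> is kept, since the final estimate must be continuous in
  \<open>\<phi>\<close>.\<close>

lemma poly_schwartz_bound:
  assumes "p \<in> poly_fun"
  shows "\<exists>C N. 0 \<le> C \<and> (\<forall>\<phi>\<in>schwartz. \<forall>u. norm (p 0 u * iter_partial is \<phi> u) \<le> C * schwartz_norm N \<phi>)"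
proof -
  obtain C N where C: "0 \<le> C" "\<And>z u. norm (p z u) \<le> C * (1 + norm z + norm u) ^ N"
    using poly_fun_bound[OF assms] by blast
  have "norm (p 0 u * iter_partial is \<phi> u) \<le> C * schwartz_norm (max N (length is)) \<phi>" if \<phi>: "\<phi> \<in> schwartz" for \<phi> u
  proof -
    have "norm (p 0 u * iter_partial is \<phi> u) \<le> (C * (1 + norm u) ^ N) * norm (iter_partial is \<phi> u)"
      using C(2)[of 0 u] by (simp add: norm_mult mult_right_mono)
    also have "\<dots> = C * ((1 + norm u) ^ N * norm (iter_partial is \<phi> u))" by simp
    also have "\<dots> \<le> C * schwartz_norm (max N (length is)) \<phi>"
      by (intro mult_left_mono C(1) order_trans[OF schwartz_seminorm_upper schwartz_seminorm_le_norm] \<phi>) auto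
    finally show ?thesis .
  qed
  then show ?thesis using C(1) by blast
qed

text \<open>Only polynomials in \<open>u\<close> are wanted here; evaluating at \<open>z = 0\<close> produces them from \<^const>\<open>poly_fun\<close>.\<close>

definition T :: "(complex^'n \<Rightarrow> real^'n \<Rightarrow> complex) \<Rightarrow> 'n list \<Rightarrow> (real^'n \<Rightarrow> complex) \<Rightarrow> complex^'n \<Rightarrow> complex" where
  "T p is \<phi> z = (\<integral>u. (p 0 u * iter_partial is \<phi> u) * K z u \<partial>lborel)"

lemma poly_schwartz_kernel_integrable:
  assumes "p \<in> poly_fun" "\<phi> \<in> schwartz"
  shows "integrable lborel (\<lambda>u. (p 0 u * iter_partial is \<phi> u) * K (cvec x y) u)"
proof -
  obtain C N where "\<And>u. norm (p 0 u * iter_partial is \<phi> u) \<le> C * schwartz_norm N \<phi>"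
    using poly_schwartz_bound[OF assms(1)] assms(2) by blast
  then show ?thesis
    by (intro integrable_mult_kernel borel_measurable_continuous_onI poly_schwartz_continuous assms)
qed

text \<open>The \<open>u\<close>-derivative of the kernel brings out
  \<open>z $ j / \<sigma> - \<beta> * u $ j\<close>. Integrating the derivative of the whole product
  to zero and solving for the \<open>z $ j\<close> term trades multiplication by a coordinate of
  \<open>z\<close> for operations on \<open>p\<close> and \<open>\<phi>\<close>.\<close>

lemma T_parts:
  assumes p: "p \<in> poly_fun" and q: "q \<in> poly_fun"
    "\<And>z u. ((\<lambda>h. p z (u + h *\<^sub>R axis j 1)) has_vector_derivative q z u) (at 0)"
    and \<phi>: "\<phi> \<in> schwartz"
  shows "cvec x y $ j * T p is \<phi> (cvec x y) = of_real \<sigma> *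
    (of_real \<beta> * T (\<lambda>z u. p z u * of_real (u $ j)) is \<phi> (cvec x y) - T q is \<phi> (cvec x y) - T p (j # is) \<phi> (cvec x y))"
proof -
  let ?z = "cvec x y"
  define \<psi> where "\<psi> u = (p 0 u * iter_partial is \<phi> u) * K ?z u" for u
  define A where "A u = (p 0 u * iter_partial is \<phi> u) * K ?z u" for u
  define B where "B u = ((p 0 u * of_real (u $ j)) * iter_partial is \<phi> u) * K ?z u" for u
  define C where "C u = (q 0 u * iter_partial is \<phi> u) * K ?z u" for u
  define D where "D u = (p 0 u * iter_partial (j # is) \<phi> u) * K ?z u" for u
  have pu: "(\<lambda>z u. p z u * of_real (u $ j)) \<in> poly_fun" by (intro poly_fun.intros p)
  have int: "integrable lborel A" "integrable lborel B" "integrable lborel C" "integrable lborel D"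
    unfolding A_def B_def C_def D_def
    using poly_schwartz_kernel_integrable[OF p \<phi>] poly_schwartz_kernel_integrable[OF pu \<phi>]
      poly_schwartz_kernel_integrable[OF q(1) \<phi>] by blast+
  have cont: "continuous_on UNIV A" "continuous_on UNIV B" "continuous_on UNIV C" "continuous_on UNIV D"
    unfolding A_def B_def C_def D_def
    by (rule continuous_on_mult[OF poly_schwartz_continuous[OF p \<phi>] continuous_kernel]
        continuous_on_mult[OF poly_schwartz_continuous[OF pu \<phi>] continuous_kernel]
        continuous_on_mult[OF poly_schwartz_continuous[OF q(1) \<phi>] continuous_kernel])+
  \<comment> \<open>Product rule for \<open>\<psi>\<close>: \<open>C\<close> differentiates the
    polynomial, \<open>D\<close> the Schwartz function, and the \<open>A\<close> and
    \<open>B\<close> terms come from the kernel.\<close>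
  define D\<psi> where "D\<psi> u = C u + D u + (?z $ j / of_real \<sigma>) * A u - of_real \<beta> * B u" for u
  have "((\<lambda>h. \<psi> (u + h *\<^sub>R axis j 1)) has_vector_derivative D\<psi> u) (at 0)" for u
    unfolding \<psi>_def
    by (rule has_vector_derivative_eq_rhs, rule has_vector_derivative_mult[OF has_vector_derivative_mult[OF
            q(2) partial_deriv_works[OF schwartz_differentiable[OF \<phi>]]] kernel_has_derivative])
      (simp add: D\<psi>_def A_def B_def C_def D_def algebra_simps)
  moreover have "continuous_on UNIV D\<psi>"
    unfolding D\<psi>_def by (intro continuous_on_add continuous_on_diff continuous_on_mult continuous_on_const cont)
  moreover have "integrable lborel \<psi>" using int(1) unfolding A_def[abs_def] \<psi>_def[abs_def] .
  moreover have "integrable lborel D\<psi>"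
    unfolding D\<psi>_def using int by auto
  ultimately have "(\<integral>u. D\<psi> u \<partial>lborel) = 0" by (rule integral_directional_derivative_eq_0)
  also have "(\<integral>u. D\<psi> u \<partial>lborel) = integral\<^sup>L lborel C + integral\<^sup>L lborel D
      + (?z $ j / of_real \<sigma>) * integral\<^sup>L lborel A - of_real \<beta> * integral\<^sup>L lborel B"
    unfolding D\<psi>_def using int by simp
  finally have 0: "integral\<^sup>L lborel C + integral\<^sup>L lborel D
      + (?z $ j / of_real \<sigma>) * integral\<^sup>L lborel A - of_real \<beta> * integral\<^sup>L lborel B = 0" .
  have T: "T p is \<phi> ?z = integral\<^sup>L lborel A" "T (\<lambda>z u. p z u * of_real (u $ j)) is \<phi> ?z = integral\<^sup>L lborel B"
    "T q is \<phi> ?z = integral\<^sup>L lborel C" "T p (j # is) \<phi> ?z = integral\<^sup>L lborel D"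
    unfolding T_def A_def B_def C_def D_def by (rule refl)+
  have "?z $ j / of_real \<sigma> * integral\<^sup>L lborel A = of_real \<beta> * integral\<^sup>L lborel B - integral\<^sup>L lborel C - integral\<^sup>L lborel D"
    using 0 by (simp add: algebra_simps eq_neg_iff_add_eq_0)
  then show ?thesis
    unfolding T using \<sigma>_pos by (simp add: field_simps)
qed

text \<open>Induction on the power: each coordinate of \<open>z\<close> is removed by
  \<open>T_parts\<close> at the price of another polynomial or one more derivative. Hence
  \<open>p\<close> and \<open>is\<close> are generalised, and \<open>N\<close> may grow with
  \<open>k\<close>. The sum of coordinate moduli is used as weight because it splits
  termwise.\<close>

lemma T_decay:
  "\<exists>C N. 0 \<le> C \<and> (\<forall>\<phi>\<in>schwartz. \<forall>x y. (1 + (\<Sum>j\<in>UNIV. norm (cvec x y $ j))) ^ k * norm (T p is \<phi> (cvec x y))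
      \<le> C * schwartz_norm N \<phi> * E x y)" if "p \<in> poly_fun"
  using that
proof (induction k arbitrary: p "is")
  case 0
  obtain C N where C: "0 \<le> C" "\<And>\<phi> u. \<phi> \<in> schwartz \<Longrightarrow> norm (p 0 u * iter_partial is \<phi> u) \<le> C * schwartz_norm N \<phi>"
    using poly_schwartz_bound[OF 0] by blast
  have "norm (T p is \<phi> (cvec x y)) \<le> (C * kernel_mass) * schwartz_norm N \<phi> * E x y" if \<phi>: "\<phi> \<in> schwartz" for \<phi> x y
    using norm_integral_mult_kernel[OF borel_measurable_continuous_onI[OF poly_schwartz_continuous[OF 0 \<phi>]] C(2)[OF \<phi>]]
    by (simp add: T_def mult_ac)
  then show ?case using C(1) kernel_mass_nonneg by (intro exI[of _ "C * kernel_mass"] exI[of _ N]) auto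
next
  case (Suc k)
  note bound_mono = mult_right_mono[OF mult_left_mono[OF schwartz_norm_mono]]
  define w where "w x y = 1 + (\<Sum>j\<in>UNIV. norm (cvec x y $ j))" for x y :: "real^'n"
  have w: "0 \<le> w x y" for x y by (simp add: w_def sum_nonneg add_nonneg_nonneg)
  have step: "\<exists>C N. 0 \<le> C \<and> (\<forall>\<phi>\<in>schwartz. \<forall>x y. w x y ^ k * (norm (cvec x y $ j) * norm (T p is \<phi> (cvec x y)))
      \<le> C * schwartz_norm N \<phi> * E x y)" for j
  proof -
    obtain q where q: "q \<in> poly_fun" "\<And>z u. ((\<lambda>h. p z (u + h *\<^sub>R axis j 1)) has_vector_derivative q z u) (at 0)"
      using poly_fun_has_derivative[OF Suc.prems] by blast
    have pu: "(\<lambda>z u. p z u * of_real (u $ j)) \<in> poly_fun" by (intro poly_fun.intros Suc.prems)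
    obtain C1 N1 where 1: "0 \<le> C1" "\<And>\<phi> x y. \<phi> \<in> schwartz \<Longrightarrow>
        w x y ^ k * norm (T (\<lambda>z u. p z u * of_real (u $ j)) is \<phi> (cvec x y)) \<le> C1 * schwartz_norm N1 \<phi> * E x y"
      using Suc.IH[OF pu, of "is"] unfolding w_def by blast
    obtain C2 N2 where 2: "0 \<le> C2" "\<And>\<phi> x y. \<phi> \<in> schwartz \<Longrightarrow>
        w x y ^ k * norm (T q is \<phi> (cvec x y)) \<le> C2 * schwartz_norm N2 \<phi> * E x y"
      using Suc.IH[OF q(1), of "is"] unfolding w_def by blast
    obtain C3 N3 where 3: "0 \<le> C3" "\<And>\<phi> x y. \<phi> \<in> schwartz \<Longrightarrow>
        w x y ^ k * norm (T p (j # is) \<phi> (cvec x y)) \<le> C3 * schwartz_norm N3 \<phi> * E x y"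
      using Suc.IH[OF Suc.prems, of "j # is"] unfolding w_def by blast
    define N where "N = max N1 (max N2 N3)"
    define C where "C = \<sigma> * (\<beta> * C1 + C2 + C3)"
    have "w x y ^ k * (norm (cvec x y $ j) * norm (T p is \<phi> (cvec x y))) \<le> C * schwartz_norm N \<phi> * E x y"
      if \<phi>: "\<phi> \<in> schwartz" for \<phi> x y
    proof -
      let ?a = "T (\<lambda>z u. p z u * of_real (u $ j)) is \<phi> (cvec x y)"
      let ?b = "T q is \<phi> (cvec x y)" and ?c = "T p (j # is) \<phi> (cvec x y)"
      let ?W = "w x y ^ k"
      have W: "0 \<le> ?W" using w by simp
      have le: "?W * norm ?a \<le> C1 * schwartz_norm N \<phi> * E x y" "?W * norm ?b \<le> C2 * schwartz_norm N \<phi> * E x y"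
        "?W * norm ?c \<le> C3 * schwartz_norm N \<phi> * E x y"
        using order_trans[OF 1(2)[OF \<phi>] bound_mono[OF \<phi>, of N1 N]] order_trans[OF 2(2)[OF \<phi>] bound_mono[OF \<phi>, of N2 N]]
          order_trans[OF 3(2)[OF \<phi>] bound_mono[OF \<phi>, of N3 N]] 1(1) 2(1) 3(1) E_pos[of x y]
        by (auto simp: N_def less_imp_le)
      have "norm (cvec x y $ j) * norm (T p is \<phi> (cvec x y)) = norm (cvec x y $ j * T p is \<phi> (cvec x y))"
        by (simp add: norm_mult)
      also have "\<dots> = \<sigma> * norm (of_real \<beta> * ?a - ?b - ?c)"
        unfolding T_parts[OF Suc.prems q \<phi>] norm_mult using \<sigma>_pos by simp
      also have "\<dots> \<le> \<sigma> * (\<beta> * norm ?a + norm ?b + norm ?c)"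
      proof (intro mult_left_mono)
        have "norm (of_real \<beta> * ?a - ?b - ?c) \<le> norm (of_real \<beta> * ?a) + norm ?b + norm ?c"
          using norm_triangle_ineq4[of "of_real \<beta> * ?a - ?b" ?c] norm_triangle_ineq4[of "of_real \<beta> * ?a" ?b] by linarith
        then show "norm (of_real \<beta> * ?a - ?b - ?c) \<le> \<beta> * norm ?a + norm ?b + norm ?c"
          using \<beta>_pos by (simp add: norm_mult)
      qed (use \<sigma>_pos in simp)
      finally have "?W * (norm (cvec x y $ j) * norm (T p is \<phi> (cvec x y)))
          \<le> ?W * (\<sigma> * (\<beta> * norm ?a + norm ?b + norm ?c))"
        using W by (rule mult_left_mono)
      also have "\<dots> = \<sigma> * (\<beta> * (?W * norm ?a) + ?W * norm ?b + ?W * norm ?c)" by (simp add: algebra_simps)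
      also have "\<dots> \<le> \<sigma> * (\<beta> * (C1 * schwartz_norm N \<phi> * E x y) + C2 * schwartz_norm N \<phi> * E x y + C3 * schwartz_norm N \<phi> * E x y)"
        using \<sigma>_pos \<beta>_pos by (intro mult_left_mono add_mono le) auto
      finally show ?thesis by (simp add: C_def algebra_simps)
    qed
    moreover have "0 \<le> C" using \<sigma>_pos \<beta>_pos 1(1) 2(1) 3(1) by (simp add: C_def)
    ultimately show ?thesis by blast
  qed
  obtain C0 N0 where 0: "0 \<le> C0" "\<And>\<phi> x y. \<phi> \<in> schwartz \<Longrightarrow>
        w x y ^ k * norm (T p is \<phi> (cvec x y)) \<le> C0 * schwartz_norm N0 \<phi> * E x y"
    using Suc.IH[OF Suc.prems, of "is"] unfolding w_def by blast
  obtain C N where C: "\<And>j. 0 \<le> C j" and N: "\<And>j \<phi> x y. \<phi> \<in> schwartz \<Longrightarrow>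
      w x y ^ k * (norm (cvec x y $ j) * norm (T p is \<phi> (cvec x y))) \<le> C j * schwartz_norm (N j) \<phi> * E x y"
    using step by metis
  \<comment> \<open>One norm for all coordinates and for the summand \<open>1\<close> of the
    weight.\<close>
  define N' where "N' = max N0 (Max (range N))"
  define C' where "C' = C0 + sum C UNIV"
  have "w x y ^ Suc k * norm (T p is \<phi> (cvec x y)) \<le> C' * schwartz_norm N' \<phi> * E x y" if \<phi>: "\<phi> \<in> schwartz" for \<phi> x y
  proof -
    have E: "0 \<le> E x y" using E_pos[of x y] by simp
    have "w x y ^ Suc k * norm (T p is \<phi> (cvec x y)) = w x y ^ k * norm (T p is \<phi> (cvec x y))
        + (\<Sum>j\<in>UNIV. w x y ^ k * (norm (cvec x y $ j) * norm (T p is \<phi> (cvec x y))))"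
    proof -
      have "w x y * n = n + (\<Sum>j\<in>UNIV. norm (cvec x y $ j) * n)" for n
        unfolding w_def by (simp only: distrib_right sum_distrib_right mult_1)
      then have "w x y ^ Suc k * n = w x y ^ k * (n + (\<Sum>j\<in>UNIV. norm (cvec x y $ j) * n))" for n
        by (simp only: power_Suc2 mult.assoc)
      then show ?thesis by (simp only: distrib_left sum_distrib_left)
    qed
    also have "\<dots> \<le> C0 * schwartz_norm N' \<phi> * E x y + (\<Sum>j\<in>UNIV. C j * schwartz_norm N' \<phi> * E x y)"
    proof (intro add_mono sum_mono)
      show "w x y ^ k * norm (T p is \<phi> (cvec x y)) \<le> C0 * schwartz_norm N' \<phi> * E x y"
        by (rule order_trans[OF 0(2)[OF \<phi>] bound_mono[OF \<phi> _ 0(1) E]]) (simp add: N'_def)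
      fix j
      have "N j \<le> N'" by (simp add: N'_def le_max_iff_disj)
      then show "w x y ^ k * (norm (cvec x y $ j) * norm (T p is \<phi> (cvec x y))) \<le> C j * schwartz_norm N' \<phi> * E x y"
        by (rule order_trans[OF N[OF \<phi>] bound_mono[OF \<phi> _ C E]])
    qed
    finally show ?thesis by (simp add: C'_def algebra_simps sum_distrib_left sum_distrib_right)
  qed
  moreover have "0 \<le> C'" using 0(1) C by (simp add: C'_def sum_nonneg)
  ultimately show ?case unfolding w_def by blast
qed

definition transform :: "(real^'n \<Rightarrow> complex) \<Rightarrow> complex^'n \<Rightarrow> complex" where
  "transform \<phi> z = (\<integral>u. \<phi> u * K z u \<partial>lborel)"

text \<open>The case of the constant polynomial and no derivatives. The exponent doubles because
  \<open>1 + (norm z)\<^sup>2\<close> is at most the square of one plus the sum of coordinate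
  moduli.\<close>

lemma transform_decay:
  "\<exists>C N. 0 \<le> C \<and> (\<forall>\<phi>\<in>schwartz. \<forall>x y. (1 + (norm (cvec x y))\<^sup>2) ^ k * norm (transform \<phi> (cvec x y))
      \<le> C * schwartz_norm N \<phi> * E x y)"
proof -
  obtain C N where C: "0 \<le> C" "\<And>\<phi> x y. \<phi> \<in> schwartz \<Longrightarrow>
     (1 + (\<Sum>j\<in>UNIV. norm (cvec x y $ j))) ^ (2 * k) * norm (T (\<lambda>z u. 1) [] \<phi> (cvec x y)) \<le> C * schwartz_norm N \<phi> * E x y"
    using T_decay[OF poly_fun.const[of 1], of "2 * k" "[]"] by blast
  have "(1 + (norm (cvec x y))\<^sup>2) ^ k * norm (transform \<phi> (cvec x y)) \<le> C * schwartz_norm N \<phi> * E x y"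
    if "\<phi> \<in> schwartz" for \<phi> x y
  proof -
    define s where "s = (\<Sum>j\<in>UNIV. norm (cvec x y $ j))"
    have s: "norm (cvec x y) \<le> s" unfolding s_def norm_vec_def by (rule L2_set_le_sum) auto
    then have "1 + (norm (cvec x y))\<^sup>2 \<le> 1 + s\<^sup>2" by (simp add: power_mono)
    also have "\<dots> \<le> (1 + s)\<^sup>2"
      using order_trans[OF norm_ge_zero s] by (simp add: power2_eq_square algebra_simps)
    finally have "(1 + (norm (cvec x y))\<^sup>2) ^ k \<le> ((1 + s)\<^sup>2) ^ k" by (intro power_mono) auto
    then have "(1 + (norm (cvec x y))\<^sup>2) ^ k * norm (transform \<phi> (cvec x y)) \<le> (1 + s) ^ (2 * k) * norm (transform \<phi> (cvec x y))"
      by (intro mult_right_mono) (auto simp: power_mult)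
    also have "\<dots> \<le> C * schwartz_norm N \<phi> * E x y"
      using C(2)[OF that, of x y] by (simp add: transform_def T_def s_def)
    finally show ?thesis .
  qed
  then show ?thesis using C(1) by blast
qed

end

section \<open>The adjoint\<close>

text \<open>A nonnegative integrand of zero integral vanishes almost everywhere, which a positive
  function cannot do on a space of positive measure. Needed to divide by the reproducing
  constant.\<close>

lemma gaussian_integral_pos:
  assumes "\<delta> > 0"
  shows "0 < (\<integral>p. exp (- \<delta> * (norm (p :: 'a::euclidean_space))\<^sup>2) \<partial>lborel)"
proof -
  let ?I = "\<integral>p. exp (- \<delta> * (norm (p :: 'a))\<^sup>2) \<partial>lborel"
  have "?I \<noteq> 0"
  proof
    assume "?I = 0"
    then have "AE p in lborel. exp (- \<delta> * (norm (p :: 'a))\<^sup>2) = 0"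
      using integrable_exp_neg_norm_sq[OF assms, where 'a='a] by (subst (asm) integral_nonneg_eq_0_iff_AE) auto
    then have "AE p::'a in lborel. False" by simp
    then have "emeasure lborel (UNIV :: 'a set) = 0"
      by (simp add: AE_iff_null null_sets_def)
    then show False by simp
  qed
  moreover have "0 \<le> ?I" by simp
  ultimately show ?thesis by linarith
qed

context mehler
begin

text \<open>\<open>\<delta> = 1 / sinh (4 * t)\<close> and
  \<open>\<kappa> = coth (4 * t) / 2\<close>, the Mehler parameters at time \<open>2 * t\<close>.
  Multiplying \<open>E\<close> by the modulus of \<open>exp (\<kappa> * z\<^sup>2)\<close> gives the
  radial weight with exponent \<open>\<delta> / 2\<close> times the squared norm of
  \<open>z\<close>.\<close>

definition \<delta> :: real where "\<delta> = (\<beta> - \<alpha>) / 2"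
definition \<kappa> :: real where "\<kappa> = (\<alpha> + \<beta>) / 4"

lemma \<delta>_pos: "0 < \<delta>"
  unfolding \<delta>_def \<alpha>_\<beta> using \<sigma>_pos \<gamma>_pos by simp

text \<open>The reciprocal of the square of \<open>E\<close>.\<close>

definition weight :: "(real^'n) \<times> (real^'n) \<Rightarrow> real" where
  "weight p = exp (\<alpha> * (norm (fst p))\<^sup>2 - \<beta> * (norm (snd p))\<^sup>2)"

abbreviation conj_pair :: "(real^'n) \<times> (real^'n) \<Rightarrow> complex^'n" where
  "conj_pair p \<equiv> cvec (fst p) (- snd p)"

lemma conj_pair_nth: "conj_pair p $ j = cnj (cpair p $ j)"
  by (simp add: cpair_def complex_eq_iff)

lemma continuous_on_transform_integrand:
  assumes "\<phi> \<in> schwartz"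
  shows "continuous_on UNIV (\<lambda>(p, u). \<phi> u * K (conj_pair p) u)"
proof -
  have \<phi>: "continuous_on UNIV \<phi>"
    using schwartz_differentiable[OF assms, of "[]"]
    by (intro continuous_at_imp_continuous_on ballI differentiable_imp_continuous_within) simp
  show ?thesis
    unfolding kernel_eq case_prod_beta' conj_pair_nth
    by (intro continuous_intros continuous_on_compose2[OF \<phi>]) auto
qed

text \<open>Joint continuity of the integrand makes the parameter integral measurable.\<close>

lemma transform_measurable:
  assumes "\<phi> \<in> schwartz"
  shows "(\<lambda>p. transform \<phi> (conj_pair p)) \<in> borel_measurable borel"
proof -
  have "(\<lambda>(p, u). \<phi> u * K (conj_pair p) u) \<in> borel_measurable (lborel \<Otimes>\<^sub>M lborel)"
    unfolding lborel_prod using borel_measurable_continuous_onI[OF continuous_on_transform_integrand[OF assms]] by simp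
  from lborel.borel_measurable_lebesgue_integral[OF this] show ?thesis
    unfolding transform_def by simp
qed

lemma transform_integrable:
  assumes "\<phi> \<in> schwartz"
  shows "integrable lborel (\<lambda>u. \<phi> u * K (cvec x y) u)"
  using poly_schwartz_kernel_integrable[OF poly_fun.const[of 1] assms, of "[]"] by simp

text \<open>The semigroup law: the right-hand side is the Mehler kernel at time
  \<open>2 * t\<close>. The product of the kernels is a Gaussian in \<open>u\<close> with linear
  coefficient \<open>(w + z) / \<sigma>\<close>, and
  \<open>1 / (4 * \<beta> * \<sigma>\<^sup>2) = \<delta> / 2\<close>.\<close>

lemma transform_kernel:
  "transform (K w) z = of_real (c0\<^sup>2 * sqrt (pi / \<beta>) ^ CARD('n)) *
     exp (- (1 / 2) * of_real \<beta> * ((\<Sum>j\<in>UNIV. (w $ j)\<^sup>2) + (\<Sum>j\<in>UNIV. (z $ j)\<^sup>2))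
          + of_real (\<delta> / 2) * (\<Sum>j\<in>UNIV. (w $ j + z $ j)\<^sup>2))"
proof -
  define b :: "complex^'n" where "b = (\<chi> j. (w $ j + z $ j) / of_real \<sigma>)"
  let ?A = "- (1 / 2) * of_real \<beta> * ((\<Sum>j\<in>UNIV. (w $ j)\<^sup>2) + (\<Sum>j\<in>UNIV. (z $ j)\<^sup>2)) :: complex"
  let ?B = "\<lambda>u::real^'n. - of_real \<beta> * (\<Sum>j\<in>UNIV. (of_real (u $ j))\<^sup>2) + (\<Sum>j\<in>UNIV. b $ j * of_real (u $ j)) :: complex"
  have eq: "K w u * K z u = of_real (c0\<^sup>2) * exp ?A * exp (?B u)" for u
  proof -
    have s: "(\<Sum>j\<in>UNIV. b $ j * of_real (u $ j)) = 1 / of_real \<sigma> * (\<Sum>j\<in>UNIV. w $ j * of_real (u $ j))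
        + 1 / of_real \<sigma> * (\<Sum>j\<in>UNIV. z $ j * of_real (u $ j))"
      by (simp add: b_def sum_distrib_left sum.distrib[symmetric] field_simps add_divide_distrib)
    have e: "(- (1 / 2) * B * (a + b) + p) + (- (1 / 2) * B * (c + b) + q) = - (1 / 2) * B * (a + c) + (- B * b + (p + q))"
      for B a b c p q :: complex
      by (simp add: field_simps)
    have "x * exp (- (1 / 2) * B * (a + b) + p) * (x * exp (- (1 / 2) * B * (c + b) + q))
        = x\<^sup>2 * exp (- (1 / 2) * B * (a + c)) * exp (- B * b + (p + q))" for x B a b c p q :: complex
    proof -
      have "x\<^sup>2 * exp (- (1 / 2) * B * (a + c)) * exp (- B * b + (p + q))
          = x\<^sup>2 * exp (- (1 / 2) * B * (a + c) + (- B * b + (p + q)))"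
        unfolding exp_add[of "- (1 / 2) * B * (a + c)" "- B * b + (p + q)"] by (simp only: mult.assoc)
      then show ?thesis
        unfolding e[of B a b p c q, symmetric] by (simp only: exp_add power2_eq_square mult_ac)
    qed
    then show ?thesis
      unfolding kernel_eq s of_real_power .
  qed
  have "(\<Sum>j\<in>UNIV. (b $ j)\<^sup>2) / (4 * of_real \<beta>) = of_real (\<delta> / 2) * (\<Sum>j\<in>UNIV. (w $ j + z $ j)\<^sup>2)"
  proof -
    have "\<delta> / 2 = 1 / (\<sigma>\<^sup>2 * (4 * \<beta>))"
      unfolding \<delta>_def \<alpha>_\<beta> using \<sigma>_pos by (simp add: coth_def power2_eq_square)
    then have "complex_of_real (\<delta> / 2) = 1 / ((of_real \<sigma>)\<^sup>2 * (4 * of_real \<beta>))" by simp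
    then show ?thesis
      by (simp only: b_def vec_lambda_beta power_divide sum_divide_distrib[symmetric]) simp
  qed
  then show ?thesis
    unfolding transform_def eq integral_mult_right_zero gaussian_integral_complex_vec(2)[OF \<beta>_pos]
    by (simp only: exp_add of_real_mult mult_ac)
qed

text \<open>Separates the exponent into a factor depending on \<open>w\<close> alone, the factor
  \<open>exp (\<kappa> * z\<^sup>2)\<close> that will be joined to \<open>F\<close>, and the Fock
  kernel with its Gaussian.\<close>

lemma kernel_product_exponent:
  fixes w :: "complex^'n"
  shows "transform (K w) (conj_pair p) * of_real (weight p) =
    of_real (c0\<^sup>2 * sqrt (pi / \<beta>) ^ CARD('n)) * exp (- of_real \<kappa> * (\<Sum>j\<in>UNIV. (w $ j)\<^sup>2)) *
    (exp (of_real \<kappa> * (\<Sum>j\<in>UNIV. (cpair p $ j)\<^sup>2)) *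
     exp (of_real \<delta> * (\<Sum>j\<in>UNIV. w $ j * cnj (cpair p $ j)) - of_real (\<delta> * (norm p)\<^sup>2)))"
proof -
  define W where "W = (\<Sum>j\<in>UNIV. (w $ j)\<^sup>2)"
  define Z where "Z = (\<Sum>j\<in>UNIV. (cpair p $ j)\<^sup>2)"
  define Z' where "Z' = (\<Sum>j\<in>UNIV. (conj_pair p $ j)\<^sup>2)"
  define S where "S = (\<Sum>j\<in>UNIV. w $ j * cnj (cpair p $ j))"
  define X where "X = (norm (fst p))\<^sup>2"
  define Y where "Y = (norm (snd p))\<^sup>2"
  have XY: "(norm p)\<^sup>2 = X + Y" by (simp add: norm_prod_def X_def Y_def)
  have wz: "(\<Sum>j\<in>UNIV. (w $ j + conj_pair p $ j)\<^sup>2) = W + Z' + 2 * S"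
    unfolding conj_pair_nth W_def Z'_def S_def
    by (simp add: power2_sum sum.distrib sum_distrib_left mult_ac)
  have "Z + Z' = of_real (2 * (X - Y))"
  proof -
    have "Z + Z' = (\<Sum>j\<in>UNIV. of_real (2 * ((fst p $ j)\<^sup>2 - (snd p $ j)\<^sup>2)))"
      unfolding Z_def Z'_def sum.distrib[symmetric]
      by (intro sum.cong) (auto simp: cpair_def complex_eq_iff power2_eq_square)
    also have "\<dots> = of_real (2 * (\<Sum>j\<in>UNIV. (fst p $ j)\<^sup>2 - (snd p $ j)\<^sup>2))"
      by (simp add: sum_distrib_left)
    also have "(\<Sum>j\<in>UNIV. (fst p $ j)\<^sup>2 - (snd p $ j)\<^sup>2) = X - Y"
      unfolding X_def Y_def power2_norm_eq_inner inner_vec_def by (simp add: power2_eq_square sum_subtractf)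
    finally show ?thesis .
  qed
  \<comment> \<open>Eliminates the antiholomorphic square: \<open>- \<kappa> * Z'\<close> yields
    \<open>\<kappa> * Z\<close>, and its real remainder combines with the weight to
    \<open>- \<delta> * (X + Y)\<close>.\<close>
  then have Z': "Z' = of_real (2 * (X - Y)) - Z" by (simp add: algebra_simps)
  have "- (1 / 2) * of_real \<beta> * (W + Z') + of_real (\<delta> / 2) * (W + Z' + 2 * S) + of_real (\<alpha> * X - \<beta> * Y)
      = - of_real \<kappa> * W + (of_real \<kappa> * Z + (of_real \<delta> * S - of_real (\<delta> * (X + Y))))"
    unfolding Z' \<delta>_def \<kappa>_def by (simp add: field_simps)
  then show ?thesis
    unfolding transform_kernel weight_def exp_of_real[symmetric] XY X_def[symmetric] Y_def[symmetric]
      W_def[symmetric] Z_def[symmetric] S_def[symmetric] wz Z'_def[symmetric]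
    by (simp only: mult.assoc exp_add[symmetric])
qed

section \<open>Construction of the distribution\<close>

lemma growth_imp_tempered:
  fixes F :: "complex^'n \<Rightarrow> complex"
  assumes F: "line_holomorphic F" and C: "0 \<le> C"
    and bound: "\<And>x y. norm (F (cvec x y)) \<le> C * (1 + (norm (cvec x y))\<^sup>2) ^ m * E x y"
  shows "\<exists>f. tempered_distribution f \<and> F = hermite_semigroup t f"
proof -
  \<comment> \<open>Decay of order \<open>m + D\<close> is requested from the transform:
    \<open>m\<close> offsets the growth of \<open>F\<close>, and \<open>D\<close> makes the rest
    integrable.\<close>
  define D where "D = DIM((real^'n) \<times> (real^'n))"
  define J where "J \<phi> = (\<integral>p. F (cpair p) * (transform \<phi> (conj_pair p) * of_real (weight p)) \<partial>lborel)"
    for \<phi> :: "real^'n \<Rightarrow> complex"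
  define c1 where "c1 = (\<integral>p. inverse ((1 + (norm (p :: (real^'n) \<times> (real^'n)))\<^sup>2) ^ D) \<partial>lborel)"
  have c1: "0 \<le> c1" by (simp add: c1_def)
  have int_inv: "integrable lborel (\<lambda>p :: (real^'n) \<times> (real^'n). inverse ((1 + (norm p)\<^sup>2) ^ D))"
    unfolding D_def by (rule integrable_inverse_power_norm)
  have contF: "continuous_on UNIV F" using F by (simp add: line_holomorphic_def)
  have mF: "(\<lambda>p. F (cpair p)) \<in> borel_measurable borel"
    by (intro borel_measurable_continuous_onI continuous_on_compose2[OF contF] continuous_intros) auto
  have mw: "weight \<in> borel_measurable borel"
    unfolding weight_def[abs_def] by (intro borel_measurable_continuous_onI continuous_intros)
  obtain A N where A: "0 \<le> A" and decay: "\<And>\<phi> x y. \<phi> \<in> schwartz \<Longrightarrow>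
      (1 + (norm (cvec x y))\<^sup>2) ^ (m + D) * norm (transform \<phi> (cvec x y)) \<le> A * schwartz_norm N \<phi> * E x y"
    using transform_decay[of "m + D"] by blast
  have pt: "norm (F (cpair p) * (transform \<phi> (conj_pair p) * of_real (weight p)))
      \<le> (C * A * schwartz_norm N \<phi>) * inverse ((1 + (norm p)\<^sup>2) ^ D)" if \<phi>: "\<phi> \<in> schwartz" for \<phi> p
  proof -
    define q where "q = 1 + (norm p)\<^sup>2"
    define e where "e = E (fst p) (snd p)"
    have q: "0 < q" and e: "0 < e" by (simp_all add: q_def e_def E_pos add_pos_nonneg)
    have n: "norm (cvec (fst p) (snd p)) = norm p" "norm (conj_pair p) = norm p"
      using norm_cpair[of p] norm_cpair[of "(fst p, - snd p)"] by (simp_all add: cpair_def norm_prod_def)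
    have F: "norm (F (cpair p)) \<le> C * q ^ m * e"
      using bound[of "fst p" "snd p"] by (simp add: n q_def e_def cpair_def)
    have "E (fst p) (- snd p) = e" by (simp add: e_def E_def)
    then have "q ^ (m + D) * norm (transform \<phi> (conj_pair p)) \<le> A * schwartz_norm N \<phi> * e"
      using decay[OF \<phi>, of "fst p" "- snd p"] by (simp add: n q_def)
    then have T: "norm (transform \<phi> (conj_pair p)) \<le> A * schwartz_norm N \<phi> * e / q ^ (m + D)"
      using q by (simp add: field_simps)
    \<comment> \<open>One factor \<open>E\<close> comes from \<open>F\<close> and one from the
      transform; conjugation leaves \<open>E\<close> unchanged, so the weight cancels both.\<close>
    have w: "weight p * e\<^sup>2 = 1"
      by (simp add: weight_def e_def E_def exp_double[symmetric] exp_add[symmetric] diff_divide_distrib)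
    have "norm (F (cpair p) * (transform \<phi> (conj_pair p) * of_real (weight p)))
        = norm (F (cpair p)) * norm (transform \<phi> (conj_pair p)) * weight p"
      by (simp add: norm_mult weight_def)
    also have "\<dots> \<le> (C * q ^ m * e) * (A * schwartz_norm N \<phi> * e / q ^ (m + D)) * weight p"
      using C q e by (intro mult_right_mono mult_mono F T) (auto simp: weight_def)
    also have "\<dots> = (C * A * schwartz_norm N \<phi>) * (q ^ m / q ^ (m + D)) * (weight p * e\<^sup>2)"
      by (simp add: power2_eq_square)
    also have "\<dots> = (C * A * schwartz_norm N \<phi>) * inverse (q ^ D)"
      unfolding w using q by (simp add: power_add field_simps)
    finally show ?thesis by (simp add: q_def)
  qed
  have int: "integrable lborel (\<lambda>p. F (cpair p) * (transform \<phi> (conj_pair p) * of_real (weight p)))"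
    if \<phi>: "\<phi> \<in> schwartz" for \<phi>
  proof (rule Bochner_Integration.integrable_bound)
    show "integrable lborel (\<lambda>p. (C * A * schwartz_norm N \<phi>) * inverse ((1 + (norm (p :: (real^'n) \<times> (real^'n)))\<^sup>2) ^ D))"
      using int_inv by (rule integrable_mult_right)
    have [measurable]: "(\<lambda>p. F (cpair p)) \<in> borel_measurable borel"
      "(\<lambda>p. transform \<phi> (conj_pair p)) \<in> borel_measurable borel" "weight \<in> borel_measurable borel"
      using mF transform_measurable[OF \<phi>] mw by auto
    show "(\<lambda>p. F (cpair p) * (transform \<phi> (conj_pair p) * of_real (weight p))) \<in> borel_measurable lborel"
      by measurable
    show "AE p in lborel. norm (F (cpair p) * (transform \<phi> (conj_pair p) * of_real (weight p)))
        \<le> norm ((C * A * schwartz_norm N \<phi>) * inverse ((1 + (norm p)\<^sup>2) ^ D))"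
      using order_trans[OF pt[OF \<phi>] abs_ge_self] by (intro AE_I2) (simp only: real_norm_def)
  qed
  have Jb: "norm (J \<phi>) \<le> (C * A * c1) * schwartz_norm N \<phi>" if \<phi>: "\<phi> \<in> schwartz" for \<phi>
  proof -
    have "norm (J \<phi>) \<le> (\<integral>p. norm (F (cpair p) * (transform \<phi> (conj_pair p) * of_real (weight p))) \<partial>lborel)"
      unfolding J_def by (rule integral_norm_bound)
    also have "\<dots> \<le> (\<integral>p. (C * A * schwartz_norm N \<phi>) * inverse ((1 + (norm (p :: (real^'n) \<times> (real^'n)))\<^sup>2) ^ D) \<partial>lborel)"
      by (rule integral_mono[OF integrable_norm[OF int[OF \<phi>]] integrable_mult_right[OF int_inv] pt[OF \<phi>]])
    also have "\<dots> = (C * A * c1) * schwartz_norm N \<phi>" by (simp add: c1_def)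
    finally show ?thesis .
  qed
  have tadd: "transform (\<lambda>u. \<phi> u + \<psi> u) (conj_pair p) = transform \<phi> (conj_pair p) + transform \<psi> (conj_pair p)"
    if "\<phi> \<in> schwartz" "\<psi> \<in> schwartz" for \<phi> \<psi> p
    unfolding transform_def distrib_right
    by (rule Bochner_Integration.integral_add[OF transform_integrable[OF that(1)] transform_integrable[OF that(2)]])
  have tscale: "transform (\<lambda>u. c * \<phi> u) z = c * transform \<phi> z" for c \<phi> z
    unfolding transform_def mult.assoc by simp
  have Jadd: "J (\<lambda>u. \<phi> u + \<psi> u) = J \<phi> + J \<psi>" if "\<phi> \<in> schwartz" "\<psi> \<in> schwartz" for \<phi> \<psi>
    unfolding J_def tadd[OF that] distrib_right distrib_left
    by (rule Bochner_Integration.integral_add[OF int[OF that(1)] int[OF that(2)]])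
  have Jscale: "J (\<lambda>u. c * \<phi> u) = c * J \<phi>" for c \<phi>
    unfolding J_def tscale by (simp add: mult.assoc mult.left_commute[of _ c])
  \<comment> \<open>Turns the anisotropic growth bound into the radial Fock bound and stays
    holomorphic on lines.\<close>
  define G where "G z = F z * exp (of_real \<kappa> * (\<Sum>j\<in>UNIV. (z $ j)\<^sup>2))" for z
  have G: "line_holomorphic G"
    unfolding line_holomorphic_def G_def
  proof (intro conjI allI)
    show "continuous_on UNIV (\<lambda>z. F z * exp (of_real \<kappa> * (\<Sum>j\<in>UNIV. (z $ j)\<^sup>2)))"
      by (intro continuous_intros contF)
    fix w \<zeta> :: "complex^'n"
    have "(\<lambda>l. exp (of_real \<kappa> * (\<Sum>j\<in>UNIV. (w $ j + l * \<zeta> $ j)\<^sup>2))) holomorphic_on UNIV"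
      by (intro holomorphic_intros)
    with F show "(\<lambda>l. F (w + l *s \<zeta>) * exp (of_real \<kappa> * (\<Sum>j\<in>UNIV. ((w + l *s \<zeta>) $ j)\<^sup>2))) holomorphic_on UNIV"
      by (auto simp: line_holomorphic_def intro: holomorphic_on_mult)
  qed
  have Gb: "norm (G z) \<le> C * (1 + (norm z)\<^sup>2) ^ m * exp (\<delta> / 2 * (norm z)\<^sup>2)" for z
  proof -
    obtain p where p: "z = cvec (fst p) (snd p)" using cpair_surj[of z] by (auto simp: cpair_def)
    let ?x = "fst p" and ?y = "snd p"
    have "Re (\<Sum>j\<in>UNIV. (z $ j)\<^sup>2) = (norm ?x)\<^sup>2 - (norm ?y)\<^sup>2"
      unfolding p power2_norm_eq_inner inner_vec_def by (simp add: power2_eq_square sum_subtractf)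
    then have "norm (G z) = norm (F z) * exp (\<kappa> * ((norm ?x)\<^sup>2 - (norm ?y)\<^sup>2))"
      by (simp add: G_def norm_mult)
    also have "\<dots> \<le> (C * (1 + (norm z)\<^sup>2) ^ m * E ?x ?y) * exp (\<kappa> * ((norm ?x)\<^sup>2 - (norm ?y)\<^sup>2))"
      unfolding p by (intro mult_right_mono bound) auto
    also have "\<dots> = C * (1 + (norm z)\<^sup>2) ^ m * (E ?x ?y * exp (\<kappa> * ((norm ?x)\<^sup>2 - (norm ?y)\<^sup>2)))"
      by (simp only: mult.assoc)
    also have "E ?x ?y * exp (\<kappa> * ((norm ?x)\<^sup>2 - (norm ?y)\<^sup>2)) = exp (\<delta> / 2 * (norm z)\<^sup>2)"
      unfolding E_def exp_add[symmetric] p norm_cvec_sq \<kappa>_def \<delta>_def by (simp add: field_simps)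
    finally show ?thesis .
  qed
  \<comment> \<open>Product of the constants from the kernel transform and the reproducing formula;
    \<open>J\<close> is divided by it at the end.\<close>
  define k where "k = c0\<^sup>2 * sqrt (pi / \<beta>) ^ CARD('n) * (\<integral>p. exp (- \<delta> * (norm (p :: (real^'n) \<times> (real^'n)))\<^sup>2) \<partial>lborel)"
  have k: "k \<noteq> 0"
    using c0_pos \<beta>_pos gaussian_integral_pos[OF \<delta>_pos, where 'a="(real^'n) \<times> (real^'n)"] by (simp add: k_def)
  have JK: "J (K w) = of_real k * F w" for w
  proof -
    let ?c = "of_real (c0\<^sup>2 * sqrt (pi / \<beta>) ^ CARD('n)) * exp (- of_real \<kappa> * (\<Sum>j\<in>UNIV. (w $ j)\<^sup>2)) :: complex"
    have "J (K w) = (\<integral>p. ?c * (G (cpair p) * exp (of_real \<delta> * (\<Sum>j\<in>UNIV. w $ j * cnj (cpair p $ j)) - of_real (\<delta> * (norm p)\<^sup>2))) \<partial>lborel)"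
      unfolding J_def kernel_product_exponent G_def by (simp only: mult_ac)
    also have "\<dots> = ?c * (G w * of_real (\<integral>p. exp (- \<delta> * (norm (p :: (real^'n) \<times> (real^'n)))\<^sup>2) \<partial>lborel))"
      unfolding integral_mult_right_zero fock_reproducing[OF G \<delta>_pos Gb] ..
    also have "\<dots> = of_real k * F w * (exp (- of_real \<kappa> * (\<Sum>j\<in>UNIV. (w $ j)\<^sup>2)) * exp (of_real \<kappa> * (\<Sum>j\<in>UNIV. (w $ j)\<^sup>2)))"
      unfolding k_def G_def of_real_mult by (simp only: mult_ac)
    finally show ?thesis by (simp add: exp_minus)
  qed
  have "tempered_distribution (\<lambda>\<phi>. J \<phi> / of_real k)"
  proof (rule tempered_distributionI)
    show "norm (J \<phi> / of_real k) \<le> (C * A * c1 / \<bar>k\<bar>) * schwartz_norm N \<phi>" if "\<phi> \<in> schwartz" for \<phi>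
      using divide_right_mono[OF Jb[OF that], of "\<bar>k\<bar>"] by (simp add: norm_divide)
  qed (simp_all add: Jadd Jscale add_divide_distrib)
  moreover have "F = hermite_semigroup t (\<lambda>\<phi>. J \<phi> / of_real k)"
    using k by (simp add: hermite_semigroup_def JK fun_eq_iff)
  ultimately show ?thesis by blast
qed

end

theorem theorem5p1:
  fixes t :: real and F :: "complex^'n::finite \<Rightarrow> complex"
  assumes "t > 0" and "entire F"
  shows "(\<exists>f :: (real^'n \<Rightarrow> complex) \<Rightarrow> complex.
            tempered_distribution f \<and> F = hermite_semigroup t f) \<longleftrightarrow>
         (\<exists>(m::nat) (C::real). \<forall>(x::real^'n) (y::real^'n).
            (cmod (F (cvec x y)))\<^sup>2 \<le>
              C * (1 + (norm (cvec x y))\<^sup>2) ^ (2 * m) *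
              exp (- (norm x)\<^sup>2 * tanh (2 * t) + (norm y)\<^sup>2 * coth (2 * t)))"
proof -
  interpret mehler t "TYPE('n)" by standard (rule assms(1))
  have E2: "(E x y)\<^sup>2 = exp (- (norm x)\<^sup>2 * tanh (2 * t) + (norm y)\<^sup>2 * coth (2 * t))" for x y
    by (simp add: E_def exp_double[symmetric] mult.commute)
  show ?thesis
    unfolding E2[symmetric]
  proof
    assume "\<exists>f. tempered_distribution f \<and> F = hermite_semigroup t f"
    then obtain f where "tempered_distribution f" "F = hermite_semigroup t f" by blast
    then show "\<exists>m C. \<forall>x y. (cmod (F (cvec x y)))\<^sup>2 \<le> C * (1 + (norm (cvec x y))\<^sup>2) ^ (2 * m) * (E x y)\<^sup>2"
      using tempered_imp_growth by (simp add: hermite_semigroup_def)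
  next
    assume "\<exists>m C. \<forall>x y. (cmod (F (cvec x y)))\<^sup>2 \<le> C * (1 + (norm (cvec x y))\<^sup>2) ^ (2 * m) * (E x y)\<^sup>2"
    then obtain m C where *: "\<And>x y. (cmod (F (cvec x y)))\<^sup>2 \<le> C * (1 + (norm (cvec x y))\<^sup>2) ^ (2 * m) * (E x y)\<^sup>2"
      by blast
    \<comment> \<open>The sign of \<open>C\<close> is not given, so the absolute value is taken
      before the square root.\<close>
    have "cmod (F (cvec x y)) \<le> sqrt \<bar>C\<bar> * (1 + (norm (cvec x y))\<^sup>2) ^ m * E x y" for x y
    proof (rule power2_le_imp_le)
      have "C * (1 + (norm (cvec x y))\<^sup>2) ^ (2 * m) * (E x y)\<^sup>2 \<le> \<bar>C\<bar> * (1 + (norm (cvec x y))\<^sup>2) ^ (2 * m) * (E x y)\<^sup>2"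
        by (intro mult_right_mono) auto
      also have "\<dots> = (sqrt \<bar>C\<bar> * (1 + (norm (cvec x y))\<^sup>2) ^ m * E x y)\<^sup>2"
        by (simp only: power_mult_distrib real_sqrt_pow2 abs_ge_zero power_mult[symmetric] mult.commute[of 2 m])
      finally show "(cmod (F (cvec x y)))\<^sup>2 \<le> (sqrt \<bar>C\<bar> * (1 + (norm (cvec x y))\<^sup>2) ^ m * E x y)\<^sup>2"
        using *[of x y] by linarith
      show "0 \<le> sqrt \<bar>C\<bar> * (1 + (norm (cvec x y))\<^sup>2) ^ m * E x y" using E_pos[of x y] by simp
    qed
    then show "\<exists>f. tempered_distribution f \<and> F = hermite_semigroup t f"
      using growth_imp_tempered[OF entire_imp_line_holomorphic[OF assms(2)], of "sqrt \<bar>C\<bar>" m] by simp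
  qed
qed

end
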